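(* There exist absolute constants $C,C'>0$ such that the following holds. Let $p=p_n$ be positive integers and $\sigma=\sigma_n$, $\Delta=\Delta_n$ be positive reals (possibly depending on $n$) such that $$\mathbf r_n:=\frac{\Delta^2/\sigma^2}{\sqrt{\Delta^2/\sigma^2+p/n}}\ge C .$$ Let $\eta^0=\mathrm{sign}(\hat v)$, where $\hat v$ is the eigenvector corresponding to the top eigenvalue of $\mathbf H(Y^\top Y)$. Then $$\sup_{(\boldsymbol\theta,\eta)\in\Omega_\Delta}\frac1n\mathbf E_{(\boldsymbol\theta,\eta)}r(\eta^0,\eta)\le\frac{C'}{\mathbf r_n^2}+\frac{32}{n^2},$$ and $$\sup_{(\boldsymbol\theta,\eta)\in\Omega_\Delta}\mathbf P_{(\boldsymbol\theta,\eta)}\left(\frac1n\left|\eta^\top\eta^0\right|\le1-\frac{\log n}{n}-\frac{C'}{\mathbf r_n^2}\right)\le\epsilon_n\Phi^{\mathsf c}(\mathbf r_n)$$ for some sequence $\epsilon_n=o(1)$.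
   Context: Model: for $n\ge 2$, $p\ge1$, $\sigma>0$, one observes $Y_i=\boldsymbol\theta\eta_i+\sigma\xi_i\in\mathbf R^p$, $i=1,\dots,n$, where $\boldsymbol\theta\in\mathbf R^p$ and $\eta\in\{-1,1\}^n$ are unknown and $\xi_1,\dots,\xi_n$ are i.i.d. standard Gaussian vectors in $\mathbf R^p$. $Y$ is the $p\times n$ matrix with columns $Y_1,\dots,Y_n$; $\mathbf P_{(\boldsymbol\theta,\eta)}$ is the law of $Y$ and $\mathbf E_{(\boldsymbol\theta,\eta)}$ the corresponding expectation. $\|\cdot\|$ is the Euclidean norm. $\Phi^{\mathsf c}(t)=\mathbf P(z>t)$ for $z$ standard Gaussian. $\Omega_\Delta=\{\boldsymbol\theta\in\mathbf R^p:\|\boldsymbol\theta\|\ge\Delta\}\times\{-1,1\}^n$. Loss: $r(\hat\eta,\eta)=\min_{\nu\in\{-1,1\}}\sum_{j=1}^n|\hat\eta_j-\nu\eta_j|$. For a square matrix $M$, $\mathbf H(M)=M-\mathrm{diag}(M)$, where $\mathrm{diag}(M)$ is the diagonal matrix with the same diagonal as $M$. $\mathrm{sign}$ is applied entrywise, with any fixed convention $\mathrm{sign}(0)\in\{-1,1\}$; the top eigenvalue is the largest one. The parameters $p,\sigma,\Delta$ may depend on $n$, and asymptotics are as $n\to\infty$. *)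

theory Defs
  imports "HOL-Probability.Probability" "Jordan_Normal_Form.Char_Poly"
begin

text \<open>Both libraries overload the indexing and inner product symbols; below they always refer to
  the dimension-carrying vectors and matrices of \<open>Jordan_Normal_Form\<close>, because
  the dimensions \<open>p\<close> and \<open>n\<close> vary. All indices are 0-based.\<close>

unbundle no vec_syntax and no inner_syntax
hide_type (open) Finite_Cartesian_Product.vec
hide_const (open) Finite_Cartesian_Product.vec Finite_Cartesian_Product.row
  Finite_Cartesian_Product.column Determinants.det

definition gauss_tail :: "real \<Rightarrow> real" where
  "gauss_tail t = measure std_normal_distribution {t<..}"

definition mat_indices :: "nat \<Rightarrow> nat \<Rightarrow> (nat \<times> nat) set" where
  "mat_indices p n = {..<p} \<times> {..<n}"

text \<open>The Borel structure on \<open>p \<times> n\<close> matrices: the smallest sigma-algebra on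
  \<^term>\<open>carrier_mat p n\<close> making all entries measurable.\<close>

definition borel_mat :: "nat \<Rightarrow> nat \<Rightarrow> real mat measure" where
  "borel_mat p n = vimage_algebra (carrier_mat p n)
     (\<lambda>A. \<lambda>ki\<in>mat_indices p n. A $$ ki) (\<Pi>\<^sub>M ki\<in>mat_indices p n. borel)"

definition vec_norm :: "real vec \<Rightarrow> real" where
  "vec_norm v = sqrt (v \<bullet> v)"

definition sign_vecs :: "nat \<Rightarrow> real vec set" where
  "sign_vecs n = {\<eta> \<in> carrier_vec n. \<forall>i<n. \<eta> $ i \<in> {-1, 1}}"

definition Omega :: "nat \<Rightarrow> nat \<Rightarrow> real \<Rightarrow> (real vec \<times> real vec) set" where
  "Omega p n \<Delta> = {\<theta> \<in> carrier_vec p. vec_norm \<theta> \<ge> \<Delta>} \<times> sign_vecs n"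

text \<open>The noise family \<open>\<omega>\<close> has i.i.d. standard normal entries, \<open>\<omega> (k, i)\<close> being the
  \<open>k\<close>-th coordinate of \<open>\<xi>\<^sub>i\<close>; the \<open>i\<close>-th column of the observation is
  \<open>\<theta> \<eta>\<^sub>i + \<sigma> \<xi>\<^sub>i\<close>.\<close>

definition noise :: "nat \<Rightarrow> nat \<Rightarrow> (nat \<times> nat \<Rightarrow> real) measure" where
  "noise p n = (\<Pi>\<^sub>M ki\<in>mat_indices p n. std_normal_distribution)"

definition observation ::
    "nat \<Rightarrow> nat \<Rightarrow> real \<Rightarrow> real vec \<Rightarrow> real vec \<Rightarrow> (nat \<times> nat \<Rightarrow> real) \<Rightarrow> real mat" where
  "observation p n \<sigma> \<theta> \<eta> \<omega> = mat p n (\<lambda>(k, i). \<theta> $ k * \<eta> $ i + \<sigma> * \<omega> (k, i))"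

definition law :: "nat \<Rightarrow> nat \<Rightarrow> real \<Rightarrow> real vec \<Rightarrow> real vec \<Rightarrow> real mat measure" where
  "law p n \<sigma> \<theta> \<eta> = distr (noise p n) (borel_mat p n) (observation p n \<sigma> \<theta> \<eta>)"

definition loss :: "nat \<Rightarrow> real vec \<Rightarrow> real vec \<Rightarrow> real" where
  "loss n \<eta>' \<eta> = Min ((\<lambda>\<nu>. \<Sum>j<n. \<bar>\<eta>' $ j - \<nu> * \<eta> $ j\<bar>) ` {-1, 1})"

definition hollow :: "real mat \<Rightarrow> real mat" where
  "hollow M = M - mat_diag (dim_row M) (\<lambda>i. M $$ (i, i))"

definition top_eigenvector :: "real mat \<Rightarrow> real vec \<Rightarrow> bool" where
  "top_eigenvector M v \<longleftrightarrow> (\<exists>\<mu>. eigenvector M v \<mu> \<and> (\<forall>\<kappa>. eigenvalue M \<kappa> \<longrightarrow> \<kappa> \<le> \<mu>))"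

text \<open>A measurable choice of a top eigenvector of the hollowed Gram matrix as a function of the
  data. No normalisation or sign is imposed.\<close>

definition spectral_selection :: "nat \<Rightarrow> nat \<Rightarrow> (real mat \<Rightarrow> real vec) \<Rightarrow> bool" where
  "spectral_selection p n v \<longleftrightarrow>
     (\<forall>Y \<in> carrier_mat p n. top_eigenvector (hollow (transpose_mat Y * Y)) (v Y)) \<and>
     (\<forall>j<n. (\<lambda>Y. v Y $ j) \<in> borel_measurable (borel_mat p n))"

text \<open>\<open>s0\<close> is the value assigned to \<open>sign 0\<close>.\<close>

definition sign_conv :: "real \<Rightarrow> real \<Rightarrow> real" where
  "sign_conv s0 x = (if x = 0 then s0 else sgn x)"

definition sign_vec :: "real \<Rightarrow> real vec \<Rightarrow> real vec" where
  "sign_vec s0 v = map_vec (sign_conv s0) v"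

definition r_ratio :: "nat \<Rightarrow> nat \<Rightarrow> real \<Rightarrow> real \<Rightarrow> real" where
  "r_ratio p n \<sigma> \<Delta> = (\<Delta>\<^sup>2 / \<sigma>\<^sup>2) / sqrt (\<Delta>\<^sup>2 / \<sigma>\<^sup>2 + real p / real n)"

end

theory Submission
  imports Defs
begin

text \<open>Put \<open>\<tau> = \<parallel>\<theta>\<parallel>\<^sup>2\<close> and let \<open>W\<close> be the \<open>p \<times> n\<close> noise matrix. Off the diagonal, \<open>Y\<^sup>T Y\<close> is
  \<open>\<tau> \<eta> \<eta>\<^sup>T\<close> plus \<open>\<sigma> (\<eta> g\<^sup>T + g \<eta>\<^sup>T) + \<sigma>\<^sup>2 (W\<^sup>T W - p I)\<close> with \<open>g = W\<^sup>T \<theta>\<close>; subtracting \<open>p I\<close> is free because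
  hollowing forgets the diagonal. So the hollowed Gram matrix is, up to a multiple of the identity, the rank
  one matrix \<open>\<tau> \<eta> \<eta>\<^sup>T\<close> with top eigenvalue \<open>n \<tau>\<close>, perturbed by the hollowed noise terms \<open>E\<close>. A top eigenvector maximises
  the Rayleigh quotient (\<open>top_eigenvector_maximises_form\<close>); comparing its quotient with that of \<open>\<eta>\<close> and
  bounding the difference of the two values of \<open>E\<close> through \<open>(v - u)\<^sup>T E (v + u)\<close> gives a Davis-Kahan bound that
  is quadratic in \<open>\<parallel>E\<parallel> / (n \<tau>)\<close>, hence at most a constant times \<open>n (\<parallel>E\<parallel> / (n \<tau>))\<^sup>2\<close> wrong signs
  (\<open>sign_errors_le\<close>). This step is deterministic.

  The size of \<open>E\<close> is governed by two noise quantities. One is \<open>\<parallel>g\<parallel>\<^sup>2 / \<tau>\<close>, a chi-square variable with \<open>n\<close> degrees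
  of freedom. The other is the operator norm of \<open>W\<^sup>T W - p I\<close>, of order \<open>n + \<surd>(p n)\<close>. It is controlled on a
  finite net with at most \<open>exp (18 n)\<close> points: at a fixed point \<open>y\<close> of the unit ball the form is a centred and
  scaled chi-square variable with \<open>p\<close> degrees of freedom, whose moment generating function at \<open>lam\<close> is at
  most \<open>exp (4 p lam\<^sup>2)\<close> for \<open>\<bar>lam\<bar> \<le> 1/4\<close> (\<open>block_squares_mgf\<close>). Summing the exponentials over the net gives a random
  variable \<open>Z\<close> with \<open>ln (E Z) \<le> 20 n + 4 p lam\<^sup>2\<close>, and the operator norm is at most \<open>2 ln Z / lam\<close>
  (\<open>net_partition_bounds\<close>, \<open>net_partition_mean\<close>).

  Write \<open>x = \<tau> / \<sigma>\<^sup>2\<close>. The definition of the ratio \<open>r\<close> gives \<open>r\<^sup>2 (x + p / n) \<le> x\<^sup>2\<close>. Taking second moments of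
  \<open>ln Z\<close> bounds the risk by a multiple of \<open>(x + p / n) / x\<^sup>2 \<le> 1 / r\<^sup>2\<close> (\<open>error_bound_mean\<close>). For the tail, an error
  proportion above \<open>ln n / n + C' / r\<^sup>2\<close> makes the chi-square variable or \<open>ln Z\<close> exceed a multiple of
  \<open>L = r\<^sup>2 ln n + C' n\<close>, if \<open>lam\<close> is well chosen. The part \<open>C' n\<close> of \<open>L\<close> pays for the net, and what is left is a
  probability of at most \<open>2 exp (- n - c r\<^sup>2 ln n)\<close> (\<open>error_bound_tail\<close>). As soon as \<open>c ln n \<ge> 1\<close> this is \<open>O(exp (- n))\<close>
  times the Gaussian tail at \<open>r\<close>, which is at least of order \<open>exp (- r\<^sup>2)\<close>; the finitely many smaller \<open>n\<close> are
  irrelevant for the limit of \<open>\<epsilon>\<close>.\<close>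

section \<open>Quadratic forms\<close>

text \<open>Vectors and matrices over \<open>{..<n}\<close> are plain functions here: the forms below are evaluated at net points,
  eigenvectors and differences of them, without carrier conditions.\<close>

definition sqnorm :: "nat \<Rightarrow> (nat \<Rightarrow> real) \<Rightarrow> real" where
  "sqnorm n x = (\<Sum>i<n. (x i)\<^sup>2)"

definition bform :: "nat \<Rightarrow> (nat \<Rightarrow> nat \<Rightarrow> real) \<Rightarrow> (nat \<Rightarrow> real) \<Rightarrow> (nat \<Rightarrow> real) \<Rightarrow> real" where
  "bform n A x y = (\<Sum>i<n. \<Sum>j<n. A i j * x i * y j)"

definition form_bounded :: "nat \<Rightarrow> (nat \<Rightarrow> nat \<Rightarrow> real) \<Rightarrow> real \<Rightarrow> bool" where
  "form_bounded n A S \<longleftrightarrow> (\<forall>x. \<bar>bform n A x x\<bar> \<le> S * sqnorm n x)"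

lemma sqnorm_nonneg [simp]: "0 \<le> sqnorm n x"
  by (simp add: sqnorm_def sum_nonneg)

lemma sqnorm_scale: "sqnorm n (\<lambda>i. c * x i) = c\<^sup>2 * sqnorm n x"
  by (simp add: sqnorm_def power_mult_distrib sum_distrib_left)

lemma sqnorm_eq_0D: "sqnorm n x = 0 \<Longrightarrow> i < n \<Longrightarrow> x i = 0"
  by (simp add: sqnorm_def sum_nonneg_eq_0_iff)

lemma sqnorm_add:
  "sqnorm n (\<lambda>i. x i + y i) = sqnorm n x + 2 * (\<Sum>i<n. x i * y i) + sqnorm n y"
  by (simp add: sqnorm_def power2_sum sum.distrib sum_distrib_left mult.assoc)

lemma sqnorm_diff:
  "sqnorm n (\<lambda>i. x i - y i) = sqnorm n x - 2 * (\<Sum>i<n. x i * y i) + sqnorm n y"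
  by (simp add: sqnorm_def power2_diff sum.distrib sum_subtractf sum_distrib_left mult.assoc)

lemma bform_add_left: "bform n A (\<lambda>i. x i + y i) z = bform n A x z + bform n A y z"
  by (simp add: bform_def sum.distrib algebra_simps)

lemma bform_add_right: "bform n A z (\<lambda>i. x i + y i) = bform n A z x + bform n A z y"
  by (simp add: bform_def sum.distrib algebra_simps)

lemma bform_scale_left: "bform n A (\<lambda>i. c * x i) z = c * bform n A x z"
  by (simp add: bform_def sum_distrib_left algebra_simps)

lemma bform_scale_right: "bform n A z (\<lambda>i. c * x i) = c * bform n A z x"
  by (simp add: bform_def sum_distrib_left algebra_simps)

lemma bform_commute:
  assumes "\<And>i j. i < n \<Longrightarrow> j < n \<Longrightarrow> A i j = A j i"
  shows "bform n A x y = bform n A y x"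
  unfolding bform_def
  by (subst sum.swap) (intro sum.cong refl, use assms in auto)

lemma bform_cong:
  assumes "\<And>i j. i < n \<Longrightarrow> j < n \<Longrightarrow> A i j = B i j" "\<And>i. i < n \<Longrightarrow> x i = x' i"
    "\<And>i. i < n \<Longrightarrow> y i = y' i"
  shows "bform n A x y = bform n B x' y'"
  unfolding bform_def using assms by (intro sum.cong refl) auto

lemma bform_mat_add: "bform n (\<lambda>i j. A i j + B i j) x y = bform n A x y + bform n B x y"
  by (simp add: bform_def sum.distrib algebra_simps)

lemma bform_mat_scale: "bform n (\<lambda>i j. c * A i j) x y = c * bform n A x y"
  by (simp add: bform_def sum_distrib_left algebra_simps)

lemma bform_rank_one: "bform n (\<lambda>i j. a i * b j) x y = (\<Sum>i<n. a i * x i) * (\<Sum>j<n. b j * y j)"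
  by (simp add: bform_def sum_product algebra_simps)

lemma bform_diag: "bform n (\<lambda>i j. if i = j then d i else 0) x x = (\<Sum>i<n. d i * (x i)\<^sup>2)"
proof -
  have "(\<Sum>j<n. (if i = j then d i else 0) * x i * x j) = d i * (x i)\<^sup>2" if "i < n" for i
  proof -
    have "(\<Sum>j<n. (if i = j then d i else 0) * x i * x j) = (\<Sum>j<n. if j = i then d i * (x i)\<^sup>2 else 0)"
      by (intro sum.cong refl) (auto simp: power2_eq_square)
    then show ?thesis using that by simp
  qed
  then show ?thesis by (simp add: bform_def)
qed

text \<open>The difference of the two values is the bilinear form at \<open>x - y\<close> and \<open>x + y\<close>, which polarisation bounds by
  \<open>S\<close> times the product of their norms. The free weight \<open>t\<close> replaces this product by the arithmetic mean
  and is chosen by each application.\<close>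

lemma form_bounded_diff:
  assumes bnd: "form_bounded n A S" and sym: "\<And>i j. i < n \<Longrightarrow> j < n \<Longrightarrow> A i j = A j i" and "t > 0"
  shows "\<bar>bform n A x x - bform n A y y\<bar>
    \<le> S / 2 * (t * sqnorm n (\<lambda>i. x i - y i) + sqnorm n (\<lambda>i. x i + y i) / t)"
proof -
  define q where "q = sqrt t"
  have q: "q > 0" "q\<^sup>2 = t" using \<open>t > 0\<close> by (auto simp: q_def)
  define a where "a = (\<lambda>i. q * (x i + (-1) * y i))"
  define b where "b = (\<lambda>i. (1/q) * (x i + y i))"
  have c: "bform n A y x = bform n A x y" using sym by (rule bform_commute)
  have "bform n A a b = bform n A x x - bform n A y y"
    unfolding a_def b_def bform_scale_left bform_scale_right bform_add_left bform_add_right c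
    using q by (simp add: field_simps)
  moreover have "bform n A b a = bform n A a b" using sym by (rule bform_commute)
  moreover have "bform n A (\<lambda>i. a i + b i) (\<lambda>i. a i + b i) - bform n A (\<lambda>i. a i + (-1) * b i) (\<lambda>i. a i + (-1) * b i)
      = 2 * (bform n A a b + bform n A b a)"
    unfolding bform_add_left bform_add_right bform_scale_left bform_scale_right by (simp add: algebra_simps)
  moreover have "\<bar>bform n A (\<lambda>i. a i + b i) (\<lambda>i. a i + b i)\<bar> \<le> S * (sqnorm n a + 2 * (\<Sum>i<n. a i * b i) + sqnorm n b)"
    using bnd unfolding form_bounded_def sqnorm_add[symmetric] by blast
  moreover have "\<bar>bform n A (\<lambda>i. a i + (-1) * b i) (\<lambda>i. a i + (-1) * b i)\<bar> \<le> S * (sqnorm n a - 2 * (\<Sum>i<n. a i * b i) + sqnorm n b)"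
  proof -
    have "sqnorm n (\<lambda>i. a i + (-1) * b i) = sqnorm n a - 2 * (\<Sum>i<n. a i * b i) + sqnorm n b"
      using sqnorm_diff[of n a b] by simp
    then show ?thesis using bnd unfolding form_bounded_def by metis
  qed
  moreover have "S * (sqnorm n a + 2 * (\<Sum>i<n. a i * b i) + sqnorm n b)
      + S * (sqnorm n a - 2 * (\<Sum>i<n. a i * b i) + sqnorm n b) = 2 * S * (sqnorm n a + sqnorm n b)"
    by (simp add: algebra_simps)
  moreover have "4 * \<bar>D\<bar> \<le> R" if "E = D" "E' = E" "P - Q = 2 * (E + E')" "\<bar>P\<bar> \<le> U" "\<bar>Q\<bar> \<le> V" "U + V = R"
    for D E E' P Q U V R :: real
    using that by (cases "D \<ge> 0") (auto simp: abs_le_iff)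
  ultimately have "4 * \<bar>bform n A x x - bform n A y y\<bar> \<le> 2 * S * (sqnorm n a + sqnorm n b)"
    by blast
  moreover have "sqnorm n a = t * sqnorm n (\<lambda>i. x i - y i)"
    unfolding a_def sqnorm_scale by (simp add: q)
  moreover have "sqnorm n b = sqnorm n (\<lambda>i. x i + y i) / t"
    unfolding b_def sqnorm_scale by (simp add: q power_divide)
  ultimately have "4 * \<bar>bform n A x x - bform n A y y\<bar>
      \<le> 2 * S * (t * sqnorm n (\<lambda>i. x i - y i) + sqnorm n (\<lambda>i. x i + y i) / t)" (is "_ \<le> 2 * S * ?Z")
    by simp
  moreover have "2 * S * ?Z = 4 * (S / 2 * ?Z)" by simp
  ultimately have "4 * \<bar>bform n A x x - bform n A y y\<bar> \<le> 4 * (S / 2 * ?Z)" by (rule ord_le_eq_trans)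
  then show ?thesis by (rule mult_left_le_imp_le) simp
qed

lemma form_bounded_Frobenius: "\<exists>K\<ge>0. form_bounded n A K"
proof -
  define K where "K = (\<Sum>i<n. \<Sum>j<n. \<bar>A i j\<bar>)"
  have "\<bar>bform n A x x\<bar> \<le> K * sqnorm n x" for x
  proof -
    have *: "\<bar>x i\<bar> * \<bar>x j\<bar> \<le> sqnorm n x" if "i < n" "j < n" for i j
    proof -
      have "(x k)\<^sup>2 \<le> sqnorm n x" if "k < n" for k
        unfolding sqnorm_def by (rule member_le_sum) (use that in auto)
      then have "(x i)\<^sup>2 \<le> sqnorm n x" "(x j)\<^sup>2 \<le> sqnorm n x" using that by auto
      moreover have "2 * (\<bar>x i\<bar> * \<bar>x j\<bar>) \<le> (x i)\<^sup>2 + (x j)\<^sup>2"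
        using sum_squares_bound[of "\<bar>x i\<bar>" "\<bar>x j\<bar>"] by (simp add: power2_abs)
      ultimately show ?thesis by linarith
    qed
    have "\<bar>bform n A x x\<bar> \<le> (\<Sum>i<n. \<Sum>j<n. \<bar>A i j * x i * x j\<bar>)"
      unfolding bform_def by (rule order.trans[OF sum_abs]) (intro sum_mono sum_abs)
    also have "\<dots> \<le> (\<Sum>i<n. \<Sum>j<n. \<bar>A i j\<bar> * sqnorm n x)"
      by (intro sum_mono) (use * in \<open>auto simp: abs_mult mult.assoc intro!: mult_left_mono\<close>)
    finally show ?thesis by (simp add: K_def sum_distrib_right)
  qed
  moreover have "K \<ge> 0" unfolding K_def by (intro sum_nonneg) auto
  ultimately show ?thesis unfolding form_bounded_def by blast
qed

text \<open>Hollowing at most doubles the bound: diagonal entries are values of the form at basis vectors.\<close>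

lemma form_bounded_hollow:
  assumes "form_bounded n A S"
  shows "form_bounded n (\<lambda>i j. if i = j then 0 else A i j) (2 * S)"
  unfolding form_bounded_def
proof
  fix x
  have d: "\<bar>A i i\<bar> \<le> S" if "i < n" for i
  proof -
    let ?e = "\<lambda>j. if j = i then 1 else 0 :: real"
    have "bform n A ?e ?e = A i i"
    proof -
      have "bform n A ?e ?e = (\<Sum>k<n. if k = i then (\<Sum>j<n. if j = i then A k j else 0) else 0)"
      proof -
        have "(\<Sum>j<n. A k j * ?e k * ?e j) = (if k = i then (\<Sum>j<n. if j = i then A k j else 0) else 0)" for k
          by (cases "k = i") (simp_all add: if_distrib cong: if_cong)
        then show ?thesis unfolding bform_def by (intro sum.cong refl)
      qed
      also have "\<dots> = A i i" using that by simp
      finally show ?thesis .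
    qed
    moreover have "sqnorm n ?e = 1"
      using that by (simp add: sqnorm_def if_distrib[of "\<lambda>z. z\<^sup>2"] cong: if_cong)
    ultimately show ?thesis using assms unfolding form_bounded_def by (metis mult.right_neutral)
  qed
  have "bform n A x x = bform n (\<lambda>i j. (if i = j then 0 else A i j) + (if i = j then A i i else 0)) x x"
    by (intro bform_cong) auto
  then have "bform n A x x = bform n (\<lambda>i j. if i = j then 0 else A i j) x x + (\<Sum>i<n. A i i * (x i)\<^sup>2)"
    by (simp only: bform_mat_add bform_diag)
  moreover have "\<bar>\<Sum>i<n. A i i * (x i)\<^sup>2\<bar> \<le> S * sqnorm n x"
  proof -
    have "\<bar>\<Sum>i<n. A i i * (x i)\<^sup>2\<bar> \<le> (\<Sum>i<n. \<bar>A i i * (x i)\<^sup>2\<bar>)" by (rule sum_abs)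
    also have "\<dots> \<le> (\<Sum>i<n. S * (x i)\<^sup>2)"
      by (intro sum_mono) (use d in \<open>auto simp: abs_mult intro!: mult_right_mono\<close>)
    finally show ?thesis by (simp add: sqnorm_def sum_distrib_left)
  qed
  moreover have "\<bar>bform n A x x\<bar> \<le> S * sqnorm n x" using assms by (simp add: form_bounded_def)
  ultimately show "\<bar>bform n (\<lambda>i j. if i = j then 0 else A i j) x x\<bar> \<le> 2 * S * sqnorm n x"
    by linarith
qed

section \<open>The top eigenvalue of a symmetric matrix\<close>

text \<open>For a positive semidefinite form \<open>B\<close>, the value at \<open>x - B x / \<beta>\<close> is nonnegative. Expanding it bounds the
  length of \<open>B x\<close> by the value at \<open>x\<close>: the form can only be small where \<open>B x\<close> is small.\<close>

lemma psd_image_bound: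
  assumes sym: "\<And>i j. i < n \<Longrightarrow> j < n \<Longrightarrow> B i j = B j i"
    and psd: "\<And>x. 0 \<le> bform n B x x" and b: "form_bounded n B \<beta>" "\<beta> > 0"
  shows "sqnorm n (\<lambda>i. \<Sum>j<n. B i j * x j) \<le> \<beta> * bform n B x x"
proof -
  define z where "z = (\<lambda>i. \<Sum>j<n. B i j * x j)"
  have zx: "bform n B z x = sqnorm n z"
    by (simp add: bform_def sqnorm_def z_def power2_eq_square sum_distrib_left mult_ac)
  have "bform n B x z = bform n B z x" using sym by (rule bform_commute)
  then have xz: "bform n B x z = sqnorm n z" using zx by simp
  have "0 \<le> bform n B (\<lambda>i. x i + (-1/\<beta>) * z i) (\<lambda>i. x i + (-1/\<beta>) * z i)" by (rule psd)
  also have "\<dots> = bform n B x x - 2 / \<beta> * sqnorm n z + bform n B z z / \<beta>\<^sup>2"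
    unfolding bform_add_left bform_add_right bform_scale_left bform_scale_right zx xz
    using b(2) by (simp add: field_simps power2_eq_square)
  also have "\<dots> \<le> bform n B x x - 2 / \<beta> * sqnorm n z + (\<beta> * sqnorm n z) / \<beta>\<^sup>2"
    using b unfolding form_bounded_def
    by (intro add_left_mono divide_right_mono) (auto intro: order.trans[OF abs_ge_self])
  also have "\<dots> = bform n B x x - sqnorm n z / \<beta>"
    using b(2) by (simp add: field_simps power2_eq_square)
  finally show ?thesis using b(2) by (simp add: z_def field_simps)
qed

lemma mult_mat_vec_index:
  fixes M :: "real mat"
  assumes "M \<in> carrier_mat n n" "v \<in> carrier_vec n" "i < n"
  shows "(M *\<^sub>v v) $ i = (\<Sum>j<n. M $$ (i, j) * v $ j)"
  using assms by (auto simp: scalar_prod_def intro!: sum.cong)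

text \<open>The supremum \<open>S\<close> of the Rayleigh quotient is an eigenvalue. Otherwise \<open>S I - M\<close> would be invertible,
  so it could not map unit vectors to arbitrarily short ones; by the previous lemma its form would then stay
  away from zero on the unit sphere, contradicting the choice of \<open>S\<close>. Hence the top eigenvalue is at least \<open>S\<close>.
  The conclusion is stated without division, for an eigenvector of any length.\<close>

lemma top_eigenvector_maximises_form:
  fixes M :: "real mat"
  assumes M: "M \<in> carrier_mat n n" and sym: "\<And>i j. i < n \<Longrightarrow> j < n \<Longrightarrow> M $$ (i, j) = M $$ (j, i)"
    and top: "top_eigenvector M v"
  shows "bform n (\<lambda>i j. M $$ (i, j)) x x * sqnorm n (\<lambda>i. v $ i)
    \<le> bform n (\<lambda>i j. M $$ (i, j)) (\<lambda>i. v $ i) (\<lambda>i. v $ i) * sqnorm n x"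
proof -
  let ?A = "\<lambda>i j. M $$ (i, j)"
  from top obtain \<mu> where ev: "eigenvector M v \<mu>" and max: "\<And>\<kappa>. eigenvalue M \<kappa> \<Longrightarrow> \<kappa> \<le> \<mu>"
    unfolding top_eigenvector_def by auto
  have v: "v \<in> carrier_vec n" "v \<noteq> 0\<^sub>v n" "M *\<^sub>v v = \<mu> \<cdot>\<^sub>v v"
    using ev M unfolding eigenvector_def by auto
  obtain K where K: "K \<ge> 0" "form_bounded n ?A K" using form_bounded_Frobenius by blast
  have n: "n > 0" using eigenvalue_imp_nonzero_dim[OF M] ev unfolding eigenvalue_def by auto
  define U where "U = {x. sqnorm n x = 1}"
  define S where "S = (SUP x\<in>U. bform n ?A x x)"
  have Une: "U \<noteq> {}"
  proof -
    have "sqnorm n (\<lambda>i. if i = 0 then 1 else 0) = 1"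
      using n by (simp add: sqnorm_def if_distrib[of "\<lambda>z. z\<^sup>2"] cong: if_cong)
    then show ?thesis unfolding U_def by blast
  qed
  have bdd: "bdd_above ((\<lambda>x. bform n ?A x x) ` U)"
  proof (rule bdd_aboveI2)
    fix x assume "x \<in> U"
    then have "sqnorm n x = 1" by (simp add: U_def)
    moreover have "\<bar>bform n ?A x x\<bar> \<le> K * sqnorm n x" using K(2) by (simp add: form_bounded_def)
    ultimately show "bform n ?A x x \<le> K" by simp
  qed
  \<comment> \<open>By homogeneity a bound on the unit sphere is a bound everywhere.\<close>
  have hom: "bform n ?A x x \<le> c * sqnorm n x"
    if c: "\<And>x. x \<in> U \<Longrightarrow> bform n ?A x x \<le> c" for c x
  proof (cases "sqnorm n x = 0")
    case True
    then have "bform n ?A x x = 0" using sqnorm_eq_0D[OF True] by (simp add: bform_def)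
    then show ?thesis using True by simp
  next
    case False
    then have pos: "sqnorm n x > 0" using sqnorm_nonneg[of n x] by linarith
    define y where "y = (\<lambda>i. (1 / sqrt (sqnorm n x)) * x i)"
    have "sqnorm n y = 1" unfolding y_def sqnorm_scale using pos by (simp add: power_divide)
    then have "y \<in> U" by (simp add: U_def)
    then have "bform n ?A y y \<le> c" by (rule c)
    then show ?thesis unfolding y_def bform_scale_left bform_scale_right using pos
      by (simp add: field_simps)
  qed
  have S: "bform n ?A x x \<le> S * sqnorm n x" for x
    by (rule hom) (auto simp: S_def intro!: cSUP_upper bdd)
  have "eigenvalue M S"
  proof (rule ccontr)
    assume "\<not> eigenvalue M S"
    then have "det (char_matrix M S) \<noteq> 0" using eigenvalue_det[OF M] by simp
    moreover have cm: "char_matrix M S \<in> carrier_mat n n" using M by simp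
    ultimately have "char_matrix M S \<in> Units (ring_mat TYPE(real) n ())"
      by (intro det_non_zero_imp_unit)
    then obtain B where B: "B \<in> carrier_mat n n" "B * char_matrix M S = 1\<^sub>m n"
      unfolding Units_def by (auto simp: ring_mat_def)
    \<comment> \<open>\<open>D\<close> is \<open>S I - M\<close>, the negative of the characteristic matrix.\<close>
    define D where "D = (\<lambda>i j. (if i = j then S else 0) + (-1) * ?A i j)"
    have Dform: "bform n D x x = S * sqnorm n x - bform n ?A x x" for x
      unfolding D_def bform_mat_add bform_diag bform_mat_scale
      by (simp add: sqnorm_def sum_distrib_left)
    have Dsym: "D i j = D j i" if "i < n" "j < n" for i j
      using sym[OF that] by (simp add: D_def)
    obtain \<beta> where beta: "\<beta> > 0" "form_bounded n D \<beta>"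
    proof -
      obtain b where "b \<ge> 0" "form_bounded n D b" using form_bounded_Frobenius by blast
      then have "form_bounded n D (b + 1)" unfolding form_bounded_def
        by (metis add.commute add_increasing distrib_right mult_1 sqnorm_nonneg)
      then show ?thesis using that[of "b + 1"] \<open>b \<ge> 0\<close> by simp
    qed
    have img: "sqnorm n (\<lambda>i. \<Sum>j<n. D i j * x j) \<le> \<beta> * bform n D x x" for x
      using psd_image_bound[OF Dsym _ beta(2,1)] S Dform by simp
    \<comment> \<open>The squared Frobenius norm of the inverse; the summand 1 only makes it positive.\<close>
    define F where "F = (\<Sum>i<n. \<Sum>j<n. (B $$ (i,j))\<^sup>2) + 1"
    have F: "F > 0" unfolding F_def by (intro add_nonneg_pos sum_nonneg) auto
    have low: "1 / (F * \<beta>) \<le> bform n D x x" if x: "x \<in> U" for x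
    proof -
      define z where "z = (\<lambda>i. \<Sum>j<n. D i j * x j)"
      let ?x = "vec n x"
      have "(char_matrix M S *\<^sub>v ?x) $ i = - z i" if "i < n" for i
      proof -
        have "(char_matrix M S *\<^sub>v ?x) $ i = (\<Sum>j<n. char_matrix M S $$ (i, j) * x j)"
          using mult_mat_vec_index[OF cm, of ?x i] that by simp
        also have "\<dots> = (\<Sum>j<n. - (D i j * x j))"
          using that M by (intro sum.cong refl) (auto simp: char_matrix_def D_def algebra_simps)
        finally show ?thesis by (simp add: z_def sum_negf)
      qed
      then have cmx: "char_matrix M S *\<^sub>v ?x = vec n (\<lambda>i. - z i)"
        using cm by (intro eq_vecI) auto
      have "?x = (B * char_matrix M S) *\<^sub>v ?x" using B by simp
      also have "\<dots> = B *\<^sub>v vec n (\<lambda>i. - z i)"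
        using B(1) cm by (subst assoc_mult_mat_vec[of _ n n _ n]) (auto simp: cmx)
      finally have xB: "?x = B *\<^sub>v vec n (\<lambda>i. - z i)" .
      have "x i = (\<Sum>j<n. B $$ (i, j) * - z j)" if "i < n" for i
      proof -
        have "x i = ?x $ i" using that by simp
        also have "\<dots> = (B *\<^sub>v vec n (\<lambda>i. - z i)) $ i" using xB by simp
        finally show ?thesis using mult_mat_vec_index[OF B(1), of "vec n (\<lambda>i. - z i)" i] that by simp
      qed
      then have "(x i)\<^sup>2 \<le> (\<Sum>j<n. (B $$ (i,j))\<^sup>2) * sqnorm n z" if "i < n" for i
        using Cauchy_Schwarz_ineq_sum[of "\<lambda>j. B $$ (i,j)" "\<lambda>j. - z j" "{..<n}"] that
        by (simp add: sqnorm_def)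
      then have "sqnorm n x \<le> (\<Sum>i<n. (\<Sum>j<n. (B $$ (i,j))\<^sup>2) * sqnorm n z)"
        unfolding sqnorm_def[of n x] by (intro sum_mono) auto
      also have "\<dots> \<le> F * sqnorm n z" by (simp add: F_def sum_distrib_right distrib_right)
      also have "\<dots> \<le> F * (\<beta> * bform n D x x)"
        using img[of x] F by (intro mult_left_mono) (auto simp: z_def)
      finally have "1 \<le> F * \<beta> * bform n D x x" using x by (simp add: U_def mult.assoc)
      then show ?thesis using F beta(1) by (simp add: field_simps)
    qed
    have "S \<le> S - 1 / (F * \<beta>)"
      unfolding S_def
    proof (rule cSUP_least[OF Une])
      fix x assume x: "x \<in> U"
      then have "sqnorm n x = 1" by (simp add: U_def)
      then show "bform n ?A x x \<le> (SUP x\<in>U. bform n ?A x x) - 1 / (F * \<beta>)"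
        using low[OF x] Dform[of x] by (simp add: S_def)
    qed
    moreover have "1 / (F * \<beta>) > 0" using F beta by simp
    ultimately show False by simp
  qed
  then have "S \<le> \<mu>" by (rule max)
  then have le: "bform n ?A x x \<le> \<mu> * sqnorm n x"
    using S[of x] mult_right_mono[OF _ sqnorm_nonneg[of n x]] by (meson order.trans)
  have "bform n ?A (\<lambda>i. v $ i) (\<lambda>i. v $ i) = (\<Sum>i<n. v $ i * (M *\<^sub>v v) $ i)"
    unfolding bform_def
    by (intro sum.cong refl, subst mult_mat_vec_index[OF M v(1)])
      (auto simp: sum_distrib_left mult_ac)
  also have "\<dots> = \<mu> * sqnorm n (\<lambda>i. v $ i)"
    unfolding v(3) sqnorm_def sum_distrib_left
    using v(1) by (intro sum.cong refl) (auto simp: power2_eq_square)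
  finally show ?thesis using mult_right_mono[OF le sqnorm_nonneg[of n "\<lambda>i. v $ i"]]
    by (simp add: algebra_simps)
qed

section \<open>Perturbation of the sign pattern\<close>

text \<open>Let \<open>u\<close> and \<open>w\<close> be the unit vectors along \<open>\<eta>\<close> and \<open>\<plusminus> v\<close>, with inner product \<open>c \<ge> 0\<close>. Maximality of \<open>v\<close> gives
  \<open>n \<tau> (1 - c\<^sup>2) \<le> E(w) - E(u)\<close>, and the right-hand side is at most \<open>2 S \<surd>(1 - c\<^sup>2)\<close>, so \<open>1 - c\<^sup>2\<close> is of second order in
  \<open>S / (n \<tau>)\<close>. A wrong sign at \<open>i\<close> costs at least \<open>u\<^sub>i\<^sup>2 = 1 / n\<close> in \<open>\<parallel>w - u\<parallel>\<^sup>2 = 2 (1 - c)\<close>; this includes \<open>v\<^sub>i = 0\<close>, whatever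
  sign is assigned there.\<close>

lemma sign_errors_le:
  fixes \<eta> v :: "nat \<Rightarrow> real"
  assumes n: "n > 0" and \<tau>: "\<tau> > 0" and S: "S > 0" "form_bounded n E S"
    and sym: "\<And>i j. i < n \<Longrightarrow> j < n \<Longrightarrow> E i j = E j i"
    and \<eta>: "\<And>i. i < n \<Longrightarrow> \<eta> i \<in> {-1, 1}" and V: "sqnorm n v > 0"
    and max: "\<And>x. (\<tau> * (\<Sum>i<n. \<eta> i * x i)\<^sup>2 + bform n E x x) * sqnorm n v
      \<le> (\<tau> * (\<Sum>i<n. \<eta> i * v i)\<^sup>2 + bform n E v v) * sqnorm n x"
  shows "\<exists>\<nu>\<in>{-1, 1}. real (card {i. i < n \<and> sign_conv s0 (v i) \<noteq> \<nu> * \<eta> i}) \<le> 8 * S\<^sup>2 / (real n * \<tau>\<^sup>2)"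
proof -
  define \<nu> :: real where "\<nu> = (if (\<Sum>i<n. \<eta> i * v i) \<ge> 0 then 1 else -1)"
  define a where "a = \<nu> / sqrt (sqnorm n v)"
  define b where "b = 1 / sqrt (real n)"
  define w where "w = (\<lambda>i. a * v i)"
  define u where "u = (\<lambda>i. b * \<eta> i)"
  define c where "c = (\<Sum>i<n. w i * u i)"
  have \<nu>: "\<nu>\<^sup>2 = 1" by (simp add: \<nu>_def)
  have a2: "a\<^sup>2 = 1 / sqnorm n v" and b2: "b\<^sup>2 = 1 / real n" and b0: "b > 0"
    using V n \<nu> by (simp_all add: a_def b_def power_divide)
  have \<eta>2: "(\<eta> i)\<^sup>2 = 1" if "i < n" for i using \<eta>[OF that] by auto
  have s\<eta>: "sqnorm n \<eta> = real n" using \<eta>2 by (simp add: sqnorm_def)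
  have su: "sqnorm n u = 1" using n by (simp add: u_def sqnorm_scale s\<eta> b2)
  have sw: "sqnorm n w = 1" using V by (simp add: w_def sqnorm_scale a2)
  have \<eta>u: "(\<Sum>i<n. \<eta> i * u i) = b * real n"
  proof -
    have "(\<Sum>i<n. \<eta> i * u i) = b * sqnorm n \<eta>"
      by (simp add: u_def sqnorm_def sum_distrib_left power2_eq_square mult_ac)
    then show ?thesis by (simp add: s\<eta>)
  qed
  have c_eq: "c = b * (\<Sum>i<n. \<eta> i * w i)"
    by (simp add: c_def u_def sum_distrib_left mult_ac)
  have "(\<Sum>i<n. \<eta> i * w i) = a * (\<Sum>i<n. \<eta> i * v i)"
    by (simp add: w_def sum_distrib_left mult_ac)
  moreover have "\<nu> * (\<Sum>i<n. \<eta> i * v i) \<ge> 0" by (simp add: \<nu>_def)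
  ultimately have "(\<Sum>i<n. \<eta> i * w i) \<ge> 0" using V by (simp add: a_def)
  then have c0: "c \<ge> 0" using b0 by (simp add: c_eq)
  have swu: "sqnorm n (\<lambda>i. w i - u i) = 2 * (1 - c)"
    unfolding sqnorm_diff su sw c_def by simp
  have swu': "sqnorm n (\<lambda>i. w i + u i) = 2 * (1 + c)"
    unfolding sqnorm_add su sw c_def by simp
  have "0 \<le> 2 * (1 - c)" unfolding swu[symmetric] by (rule sqnorm_nonneg)
  then have c1: "c \<le> 1" by simp
  have "\<tau> * (\<Sum>i<n. \<eta> i * u i)\<^sup>2 + bform n E u u \<le> \<tau> * (\<Sum>i<n. \<eta> i * w i)\<^sup>2 + bform n E w w"
  proof -
    have "\<tau> * (\<Sum>i<n. \<eta> i * w i)\<^sup>2 + bform n E w w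
        = a\<^sup>2 * (\<tau> * (\<Sum>i<n. \<eta> i * v i)\<^sup>2 + bform n E v v)"
    proof -
      have "(\<Sum>i<n. \<eta> i * w i) = a * (\<Sum>i<n. \<eta> i * v i)"
        by (simp add: w_def sum_distrib_left mult_ac)
      moreover have "bform n E w w = a * (a * bform n E v v)"
        unfolding w_def bform_scale_left bform_scale_right ..
      ultimately show ?thesis by (simp add: power2_eq_square algebra_simps)
    qed
    moreover have "\<tau> * (\<Sum>i<n. \<eta> i * u i)\<^sup>2 + bform n E u u
        \<le> (\<tau> * (\<Sum>i<n. \<eta> i * v i)\<^sup>2 + bform n E v v) / sqnorm n v"
      using max[of u] V by (simp add: su pos_le_divide_eq)
    ultimately show ?thesis by (simp add: a2)
  qed
  moreover have "(\<Sum>i<n. \<eta> i * u i)\<^sup>2 = real n"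
    using n by (simp add: \<eta>u power_mult_distrib b2 power2_eq_square[of "real n"])
  moreover have "(\<Sum>i<n. \<eta> i * w i)\<^sup>2 = real n * c\<^sup>2"
    using n by (simp add: c_eq power_mult_distrib b2)
  ultimately have gap: "\<tau> * real n * (1 - c\<^sup>2) \<le> \<bar>bform n E w w - bform n E u u\<bar>"
    by (simp add: algebra_simps)
  \<comment> \<open>The two factors \<open>1 - c\<close> and \<open>1 + c\<close> are balanced so that half of the gap is absorbed on the left.\<close>
  define t where "t = \<tau> * real n * (1 + c) / (2 * S)"
  have t: "t > 0" using \<tau> n S c0 by (simp add: t_def)
  have "\<bar>bform n E w w - bform n E u u\<bar> \<le> S / 2 * (t * (2 * (1 - c)) + 2 * (1 + c) / t)"
    using form_bounded_diff[OF S(2) sym t, of w u] unfolding swu swu' .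
  also have "\<dots> = \<tau> * real n * (1 - c\<^sup>2) / 2 + 2 * S\<^sup>2 / (\<tau> * real n)"
    using \<tau> n S c0 by (simp add: t_def field_simps power2_eq_square add_nonneg_eq_0_iff)
  finally have "\<tau> * real n * (1 - c\<^sup>2) \<le> 4 * S\<^sup>2 / (\<tau> * real n)"
    using gap by simp
  then have c2: "1 - c\<^sup>2 \<le> 4 * S\<^sup>2 / (\<tau> * real n)\<^sup>2"
    using \<tau> n by (simp add: field_simps power2_eq_square)
  let ?Err = "{i. i < n \<and> sign_conv s0 (v i) \<noteq> \<nu> * \<eta> i}"
  have err: "1 / real n \<le> (w i - u i)\<^sup>2" if "i \<in> ?Err" for i
  proof -
    from that have i: "i < n" "sign_conv s0 (v i) \<noteq> \<nu> * \<eta> i" by auto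
    have "\<nu> * v i * \<eta> i \<le> 0"
      using i(2) \<eta>[OF i(1)]
      by (auto simp: sign_conv_def sgn_if \<nu>_def split: if_splits)
    then have "w i * u i \<le> 0"
      using b0 V by (simp add: w_def u_def a_def mult_le_0_iff zero_le_mult_iff divide_le_0_iff
          zero_le_divide_iff)
    then have "2 * (w i * u i) \<le> (w i)\<^sup>2" by - (rule order.trans[of _ 0], simp_all add: mult.commute)
    then have "(u i)\<^sup>2 \<le> (w i - u i)\<^sup>2" by (simp add: power2_diff mult.assoc)
    moreover have "(u i)\<^sup>2 = 1 / real n" using \<eta>2[OF i(1)] by (simp add: u_def power_mult_distrib b2)
    ultimately show ?thesis by simp
  qed
  have "real (card ?Err) / real n = (\<Sum>i\<in>?Err. 1 / real n)" by simp
  also have "\<dots> \<le> (\<Sum>i\<in>?Err. (w i - u i)\<^sup>2)" by (intro sum_mono err)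
  also have "\<dots> \<le> sqnorm n (\<lambda>i. w i - u i)"
    unfolding sqnorm_def by (intro sum_mono2) auto
  also have "\<dots> \<le> 2 * (1 - c\<^sup>2)"
  proof -
    have "c\<^sup>2 \<le> c" using c0 c1 by (simp add: power2_eq_square mult_left_le)
    then show ?thesis unfolding swu by simp
  qed
  finally have "real (card ?Err) / real n \<le> 8 * S\<^sup>2 / (\<tau> * real n)\<^sup>2" using c2 by simp
  then have "real (card ?Err) \<le> 8 * S\<^sup>2 / (real n * \<tau>\<^sup>2)"
    using n \<tau> by (simp add: field_simps power2_eq_square)
  moreover have "\<nu> \<in> {-1, 1}" by (simp add: \<nu>_def)
  ultimately show ?thesis by blast
qed

lemma loss_and_overlap:
  assumes \<eta>: "\<eta> \<in> sign_vecs n" and \<eta>': "\<eta>' \<in> sign_vecs n" and \<nu>: "\<nu> \<in> {-1, 1}"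
    and K: "real (card {i. i < n \<and> \<eta>' $ i \<noteq> \<nu> * \<eta> $ i}) \<le> K"
  shows "loss n \<eta>' \<eta> \<le> 2 * K" and "real n - 2 * K \<le> \<bar>\<eta> \<bullet> \<eta>'\<bar>"
proof -
  let ?Err = "{i. i < n \<and> \<eta>' $ i \<noteq> \<nu> * \<eta> $ i}"
  have vals: "\<eta> $ i \<in> {-1, 1}" "\<eta>' $ i \<in> {-1, 1}" if "i < n" for i
    using \<eta> \<eta>' that by (auto simp: sign_vecs_def)
  have count: "real (card ?Err) = (\<Sum>j<n. if \<eta>' $ j \<noteq> \<nu> * \<eta> $ j then 1 else 0)"
    by (subst sum.If_cases) (auto simp: Int_def)
  have "(\<Sum>j<n. \<bar>\<eta>' $ j - \<nu> * \<eta> $ j\<bar>) = (\<Sum>j<n. 2 * (if \<eta>' $ j \<noteq> \<nu> * \<eta> $ j then 1 else 0))"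
    using vals \<nu> by (intro sum.cong refl) fastforce
  also have "\<dots> = 2 * real (card ?Err)" unfolding count sum_distrib_left ..
  finally have "(\<Sum>j<n. \<bar>\<eta>' $ j - \<nu> * \<eta> $ j\<bar>) \<le> 2 * K" using K by simp
  moreover have "loss n \<eta>' \<eta> \<le> (\<Sum>j<n. \<bar>\<eta>' $ j - \<nu> * \<eta> $ j\<bar>)"
    unfolding loss_def by (intro Min_le) (use \<nu> in auto)
  ultimately show "loss n \<eta>' \<eta> \<le> 2 * K" by linarith
  have "\<eta> \<bullet> \<eta>' = (\<Sum>j<n. \<eta> $ j * \<eta>' $ j)"
    using \<eta>' by (auto simp: sign_vecs_def scalar_prod_def atLeast0LessThan)
  then have "\<nu> * (\<eta> \<bullet> \<eta>') = (\<Sum>j<n. \<nu> * (\<eta> $ j * \<eta>' $ j))" by (simp add: sum_distrib_left)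
  also have "\<dots> = (\<Sum>j<n. 1 - 2 * (if \<eta>' $ j \<noteq> \<nu> * \<eta> $ j then 1 else 0))"
    using vals \<nu> by (intro sum.cong refl) fastforce
  also have "\<dots> = real n - 2 * real (card ?Err)"
    unfolding count sum_distrib_left by (simp add: sum_subtractf)
  finally have "real n - 2 * real (card ?Err) \<le> \<bar>\<nu> * (\<eta> \<bullet> \<eta>')\<bar>" by simp
  moreover have "\<bar>\<nu> * (\<eta> \<bullet> \<eta>')\<bar> = \<bar>\<eta> \<bullet> \<eta>'\<bar>" using \<nu> by (auto simp: abs_mult)
  ultimately show "real n - 2 * K \<le> \<bar>\<eta> \<bullet> \<eta>'\<bar>" using K by linarith
qed

lemma abs_weighted_sum_le:
  "\<bar>\<Sum>i<n. a i * x i\<bar> \<le> sqrt (sqnorm n a) * sqrt (sqnorm n x)"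
proof -
  have "(\<Sum>i<n. a i * x i)\<^sup>2 \<le> sqnorm n a * sqnorm n x"
    using Cauchy_Schwarz_ineq_sum[of a x "{..<n}"] by (simp add: sqnorm_def)
  then show ?thesis using real_sqrt_le_mono by (fastforce simp: real_sqrt_mult)
qed

definition noise_projection :: "nat \<Rightarrow> real vec \<Rightarrow> (nat \<times> nat \<Rightarrow> real) \<Rightarrow> nat \<Rightarrow> real" where
  "noise_projection p \<theta> \<omega> i = (\<Sum>k<p. \<theta> $ k * \<omega> (k, i))"

text \<open>Centred at its mean \<open>p I\<close>, so that its form at a fixed vector has mean zero.\<close>

definition noise_gram :: "nat \<Rightarrow> (nat \<times> nat \<Rightarrow> real) \<Rightarrow> nat \<Rightarrow> nat \<Rightarrow> real" where
  "noise_gram p \<omega> i j = (\<Sum>k<p. \<omega> (k, i) * \<omega> (k, j)) - (if i = j then real p else 0)"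

text \<open>The perturbation \<open>E\<close> is the hollowing of \<open>\<sigma> (\<eta> g\<^sup>T + g \<eta>\<^sup>T) + \<sigma>\<^sup>2 (W\<^sup>T W - p I)\<close>, where \<open>g\<close> is the projected noise. Since
  the hollow matrix of the rank one part differs from it by \<open>\<tau> I\<close> only, the eigenvectors of the hollowed
  Gram matrix are those of \<open>\<tau> \<eta> \<eta>\<^sup>T + E\<close>.\<close>

lemma spectral_errors_pathwise:
  assumes n: "n > 0" and \<sigma>: "\<sigma> > 0" and \<theta>: "\<theta> \<in> carrier_vec p" and \<tau>: "\<tau> = (\<Sum>k<p. (\<theta> $ k)\<^sup>2)" "\<tau> > 0"
    and \<eta>: "\<eta> \<in> sign_vecs n" and s0: "s0 \<in> {-1, 1}"
    and S: "S > 0" "form_bounded n (noise_gram p \<omega>) S"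
    and Y: "Y = observation p n \<sigma> \<theta> \<eta> \<omega>"
    and top: "top_eigenvector (hollow (transpose_mat Y * Y)) v"
    and D: "D = 16 * (4 * \<sigma> * sqrt (real n * sqnorm n (noise_projection p \<theta> \<omega>)) + 2 * \<sigma>\<^sup>2 * S)\<^sup>2
      / (real n * \<tau>)\<^sup>2"
  shows "1 / real n * loss n (sign_vec s0 v) \<eta> \<le> D"
    and "1 - D \<le> 1 / real n * \<bar>\<eta> \<bullet> sign_vec s0 v\<bar>"
proof -
  define g where "g = noise_projection p \<theta> \<omega>"
  define R where "R = noise_gram p \<omega>"
  define G where "G = sqnorm n g"
  define e where "e = (\<lambda>i. \<eta> $ i)"
  define B where "B = (\<lambda>i j. \<sigma> * (e i * g j + g i * e j) + \<sigma>\<^sup>2 * R i j)"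
  define E where "E = (\<lambda>i j. if i = j then 0 else B i j)"
  \<comment> \<open>A bound for the form of \<open>E\<close>; the factor 2 is the price of hollowing.\<close>
  define T where "T = 2 * (2 * \<sigma> * sqrt (real n * G) + \<sigma>\<^sup>2 * S)"
  let ?M = "hollow (transpose_mat Y * Y)"
  have Yc: "Y \<in> carrier_mat p n" by (simp add: Y observation_def)
  have M: "?M \<in> carrier_mat n n" using Yc by (auto simp: hollow_def mat_diag_def)
  have e: "e i \<in> {-1, 1}" if "i < n" for i using \<eta> that by (auto simp: e_def sign_vecs_def)
  have se: "sqnorm n e = real n"
  proof -
    have "(e i)\<^sup>2 = 1" if "i < n" for i using e[OF that] by auto
    then show ?thesis by (simp add: sqnorm_def)
  qed
  have YY: "?M $$ (i, j) = (if i = j then 0 else (\<Sum>k<p. Y $$ (k, i) * Y $$ (k, j)))" if "i < n" "j < n" for i j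
    using Yc that by (auto simp: hollow_def mat_diag_def scalar_prod_def atLeast0LessThan)
  have prod: "(\<Sum>k<p. Y $$ (k, i) * Y $$ (k, j)) = \<tau> * (e i * e j) + B i j" if "i < n" "j < n" "i \<noteq> j" for i j
  proof -
    have "(\<Sum>k<p. Y $$ (k, i) * Y $$ (k, j))
        = (\<Sum>k<p. (\<theta> $ k)\<^sup>2 * (e i * e j) + \<sigma> * (e i * (\<theta> $ k * \<omega> (k, j)) + \<theta> $ k * \<omega> (k, i) * e j)
            + \<sigma>\<^sup>2 * (\<omega> (k, i) * \<omega> (k, j)))"
      using that by (intro sum.cong refl)
        (simp add: Y observation_def e_def power2_eq_square algebra_simps)
    also have "\<dots> = \<tau> * (e i * e j) + B i j"
      using that(3)
      by (simp add: \<tau> B_def R_def noise_gram_def g_def noise_projection_def sum.distrib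
          sum_distrib_left sum_distrib_right distrib_left distrib_right mult_ac)
    finally show ?thesis .
  qed
  have symM: "?M $$ (i, j) = ?M $$ (j, i)" if "i < n" "j < n" for i j
    using that by (auto simp: YY mult.commute)
  have symE: "E i j = E j i" for i j
    by (auto simp: E_def B_def R_def noise_gram_def mult.commute add.commute)
  have qM: "bform n (\<lambda>i j. ?M $$ (i, j)) x x
      = \<tau> * (\<Sum>i<n. e i * x i)\<^sup>2 - \<tau> * sqnorm n x + bform n E x x" for x
  proof -
    have "bform n (\<lambda>i j. ?M $$ (i, j)) x x
        = bform n (\<lambda>i j. (\<tau> * (e i * e j) + (-\<tau>) * (if i = j then 1 else 0)) + E i j) x x"
    proof (rule bform_cong)
      fix i j assume "i < n" "j < n"
      moreover have "e i * e i = 1" using e[OF \<open>i < n\<close>] by auto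
      ultimately show "?M $$ (i, j) = (\<tau> * (e i * e j) + (-\<tau>) * (if i = j then 1 else 0)) + E i j"
        by (cases "i = j") (simp_all add: YY prod E_def)
    qed auto
    then show ?thesis
      unfolding bform_mat_add bform_mat_scale bform_rank_one bform_diag
      by (simp add: sqnorm_def power2_eq_square)
  qed
  have "form_bounded n B (2 * \<sigma> * sqrt (real n * G) + \<sigma>\<^sup>2 * S)"
    unfolding form_bounded_def
  proof
    fix x
    define P where "P = (\<Sum>i<n. e i * x i) * (\<Sum>i<n. g i * x i)"
    have "bform n B x x = 2 * \<sigma> * P + \<sigma>\<^sup>2 * bform n R x x"
      unfolding B_def bform_mat_add bform_mat_scale bform_rank_one P_def by (simp add: algebra_simps)
    then have "\<bar>bform n B x x\<bar> \<le> 2 * \<sigma> * \<bar>P\<bar> + \<sigma>\<^sup>2 * \<bar>bform n R x x\<bar>"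
      using abs_triangle_ineq[of "2 * \<sigma> * P" "\<sigma>\<^sup>2 * bform n R x x"] \<sigma> by (simp add: abs_mult)
    also have "\<dots> \<le> 2 * \<sigma> * (sqrt (real n * G) * sqnorm n x) + \<sigma>\<^sup>2 * (S * sqnorm n x)"
    proof (intro add_mono mult_left_mono)
      have "\<bar>P\<bar> \<le> (sqrt (sqnorm n e) * sqrt (sqnorm n x)) * (sqrt (sqnorm n g) * sqrt (sqnorm n x))"
        unfolding abs_mult P_def by (intro mult_mono abs_weighted_sum_le) auto
      also have "\<dots> = sqrt (real n) * sqrt G * (sqrt (sqnorm n x) * sqrt (sqnorm n x))"
        by (simp only: se G_def mult_ac)
      also have "\<dots> = sqrt (real n * G) * sqnorm n x" by (simp add: real_sqrt_mult)
      finally show "\<bar>P\<bar> \<le> sqrt (real n * G) * sqnorm n x" .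
      show "\<bar>bform n R x x\<bar> \<le> S * sqnorm n x"
        using S(2) by (simp add: R_def form_bounded_def)
    qed (use \<sigma> in auto)
    finally have "\<bar>bform n B x x\<bar> \<le> 2 * \<sigma> * (sqrt (real n * G) * sqnorm n x) + \<sigma>\<^sup>2 * (S * sqnorm n x)" .
    then show "\<bar>bform n B x x\<bar> \<le> (2 * \<sigma> * sqrt (real n * G) + \<sigma>\<^sup>2 * S) * sqnorm n x"
      by (simp add: algebra_simps)
  qed
  from form_bounded_hollow[OF this] have Eb: "form_bounded n E T" by (simp add: E_def T_def)
  have T0: "T > 0" using \<sigma> S n by (simp add: T_def G_def add_nonneg_pos)
  obtain \<mu> where "eigenvector ?M v \<mu>" using top unfolding top_eigenvector_def by auto
  then have v: "v \<in> carrier_vec n" "v \<noteq> 0\<^sub>v n" using M unfolding eigenvector_def by auto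
  have V: "sqnorm n (\<lambda>i. v $ i) > 0"
  proof (rule ccontr)
    assume "\<not> ?thesis"
    then have "sqnorm n (\<lambda>i. v $ i) = 0" using sqnorm_nonneg[of n "\<lambda>i. v $ i"] by linarith
    then have "v = 0\<^sub>v n" using v(1) by (intro eq_vecI) (auto dest: sqnorm_eq_0D)
    then show False using v(2) by simp
  qed
  have max: "(\<tau> * (\<Sum>i<n. e i * x i)\<^sup>2 + bform n E x x) * sqnorm n (\<lambda>i. v $ i)
      \<le> (\<tau> * (\<Sum>i<n. e i * v $ i)\<^sup>2 + bform n E (\<lambda>i. v $ i) (\<lambda>i. v $ i)) * sqnorm n x" for x
    using top_eigenvector_maximises_form[OF M symM top, of x] unfolding qM
    by (simp add: algebra_simps)
  have "\<exists>\<nu>\<in>{-1, 1}. real (card {i. i < n \<and> sign_conv s0 (v $ i) \<noteq> \<nu> * e i}) \<le> 8 * T\<^sup>2 / (real n * \<tau>\<^sup>2)"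
    using sign_errors_le[OF n \<tau>(2) T0 Eb symE e V max, of s0] .
  then obtain \<nu> where \<nu>: "\<nu> \<in> {-1, 1}"
    and K: "real (card {i. i < n \<and> sign_conv s0 (v $ i) \<noteq> \<nu> * e i}) \<le> 8 * T\<^sup>2 / (real n * \<tau>\<^sup>2)"
    by blast
  have sv: "sign_vec s0 v \<in> sign_vecs n"
    using v(1) s0 by (auto simp: sign_vec_def sign_vecs_def sign_conv_def sgn_if)
  have "{i. i < n \<and> sign_vec s0 v $ i \<noteq> \<nu> * \<eta> $ i} = {i. i < n \<and> sign_conv s0 (v $ i) \<noteq> \<nu> * e i}"
  proof (rule Collect_cong, rule conj_cong[OF refl])
    fix i assume "i < n"
    then have "sign_vec s0 v $ i = sign_conv s0 (v $ i)" using v(1) by (simp add: sign_vec_def)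
    then show "(sign_vec s0 v $ i \<noteq> \<nu> * \<eta> $ i) = (sign_conv s0 (v $ i) \<noteq> \<nu> * e i)"
      by (simp only: e_def)
  qed
  moreover have "8 * T\<^sup>2 / (real n * \<tau>\<^sup>2) = real n * D / 2"
  proof -
    have "4 * \<sigma> * sqrt (real n * G) + 2 * \<sigma>\<^sup>2 * S = T" by (simp add: T_def)
    then have "D = 16 * T\<^sup>2 / (real n * \<tau>)\<^sup>2" unfolding D G_def g_def by simp
    then show ?thesis using n by (simp add: power_mult_distrib power2_eq_square[of "real n"])
  qed
  ultimately have K': "real (card {i. i < n \<and> sign_vec s0 v $ i \<noteq> \<nu> * \<eta> $ i}) \<le> real n * D / 2"
    using K by simp
  from loss_and_overlap[OF \<eta> sv \<nu> K'] n
  show "1 / real n * loss n (sign_vec s0 v) \<eta> \<le> D" "1 - D \<le> 1 / real n * \<bar>\<eta> \<bullet> sign_vec s0 v\<bar>"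
    by (simp_all add: field_simps)
qed

section \<open>Exponential moments of Gaussian squares\<close>

lemma exp_times_inverse_sqrt_le:
  fixes u :: real
  assumes "\<bar>u\<bar> \<le> 1/4"
  shows "exp (- u) / sqrt (1 - 2 * u) \<le> exp (4 * u\<^sup>2)"
proof -
  have pos: "1 - 2 * u > 0" using assms by linarith
  have "\<bar>ln (1 + (- (2 * u))) - (- (2 * u))\<bar> \<le> 2 * (- (2 * u))\<^sup>2"
    by (rule abs_ln_one_plus_x_minus_x_bound) (use assms in auto)
  then have "- u - ln (1 - 2 * u) / 2 \<le> 4 * u\<^sup>2" by (simp add: power_mult_distrib abs_le_iff)
  moreover have "exp (- u) / sqrt (1 - 2 * u) = exp (- u - ln (1 - 2 * u) / 2)"
    using pos by (simp add: exp_diff ln_sqrt[symmetric])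
  ultimately show ?thesis by simp
qed

text \<open>Multiplying a centred normal density by \<open>exp (l y\<^sup>2)\<close> gives a multiple of the normal density with
  variance \<open>s\<^sup>2 / (1 - 2 l s\<^sup>2)\<close>, so the moment generating function is known exactly. Centring the square removes
  the linear term in \<open>l\<close> of its logarithm and leaves a quadratic one, for both signs of \<open>l\<close>.\<close>

lemma (in prob_space) normal_square_mgf:
  assumes X: "distributed M lborel X (normal_density 0 s)" and s: "s > 0" and l: "\<bar>l * s\<^sup>2\<bar> \<le> 1/4"
  shows "integrable M (\<lambda>\<omega>. exp (l * ((X \<omega>)\<^sup>2 - s\<^sup>2)))"
    and "expectation (\<lambda>\<omega>. exp (l * ((X \<omega>)\<^sup>2 - s\<^sup>2))) \<le> exp (4 * l\<^sup>2 * s ^ 4)"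
proof -
  define d where "d = 1 - 2 * (l * s\<^sup>2)"
  have d: "d > 0" using l unfolding d_def by linarith
  define t where "t = s / sqrt d"
  define c where "c = exp (- (l * s\<^sup>2)) / sqrt d"
  have t: "t > 0" using s d by (simp add: t_def)
  let ?g = "\<lambda>x. exp (l * (x\<^sup>2 - s\<^sup>2))"
  have eq: "normal_density 0 s x * ?g x = c * normal_density 0 t x" for x
  proof -
    have "- (x\<^sup>2) / (2 * s\<^sup>2) + l * (x\<^sup>2 - s\<^sup>2) = - (l * s\<^sup>2) + - (x\<^sup>2) / (2 * t\<^sup>2)"
      using s d by (simp add: t_def power_divide d_def field_simps power2_eq_square)
    then have "exp (- (x\<^sup>2) / (2 * s\<^sup>2)) * ?g x = exp (- (l * s\<^sup>2)) * exp (- (x\<^sup>2) / (2 * t\<^sup>2))"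
      by (simp only: exp_add[symmetric])
    moreover have "1 / sqrt (2 * pi * s\<^sup>2) = (1 / sqrt d) * (1 / sqrt (2 * pi * t\<^sup>2))"
      using s d by (simp add: t_def power_divide real_sqrt_divide real_sqrt_mult)
    ultimately show ?thesis unfolding normal_density_def c_def by simp
  qed
  have "integrable lborel (\<lambda>x. normal_density 0 s x * ?g x)" unfolding eq using t by simp
  then show "integrable M (\<lambda>\<omega>. exp (l * ((X \<omega>)\<^sup>2 - s\<^sup>2)))"
    using distributed_integrable[OF X, of ?g] by simp
  have "expectation (\<lambda>\<omega>. exp (l * ((X \<omega>)\<^sup>2 - s\<^sup>2))) = (\<integral>x. normal_density 0 s x * ?g x \<partial>lborel)"
    using distributed_integral[OF X, of ?g] by simp
  also have "\<dots> = c" unfolding eq using t by simp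
  also have "c \<le> exp (4 * (l * s\<^sup>2)\<^sup>2)"
    unfolding c_def d_def using l by (rule exp_times_inverse_sqrt_le)
  also have "\<dots> = exp (4 * l\<^sup>2 * s ^ 4)" by (simp add: power_mult_distrib)
  finally show "expectation (\<lambda>\<omega>. exp (l * ((X \<omega>)\<^sup>2 - s\<^sup>2))) \<le> exp (4 * l\<^sup>2 * s ^ 4)" .
qed

lemma prob_space_std_normal: "prob_space std_normal_distribution"
  by (rule prob_space_normal_density) simp

lemma indep_coordinates:
  assumes "finite J"
  shows "prob_space.indep_vars (\<Pi>\<^sub>M j\<in>J. std_normal_distribution) (\<lambda>_. borel) (\<lambda>j \<omega>. \<omega> j) J"
proof (cases "J = {}")
  case True
  interpret prob_space "\<Pi>\<^sub>M j\<in>J. std_normal_distribution" by (intro prob_space_PiM prob_space_std_normal)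
  show ?thesis unfolding indep_vars_def indep_sets_def using True by simp
next
  case False
  let ?M = "\<Pi>\<^sub>M j\<in>J. std_normal_distribution"
  interpret prob_space ?M by (intro prob_space_PiM prob_space_std_normal)
  have rv: "random_variable borel (\<lambda>\<omega>. \<omega> j)" if "j \<in> J" for j
    using measurable_component_singleton[OF that, of "\<lambda>_. std_normal_distribution"] by simp
  have comp: "distr ?M borel (\<lambda>\<omega>. \<omega> j) = std_normal_distribution" if "j \<in> J" for j
  proof -
    have "distr ?M borel (\<lambda>\<omega>. \<omega> j) = distr ?M std_normal_distribution (\<lambda>\<omega>. \<omega> j)"
      by (rule distr_cong) auto
    then show ?thesis using distr_PiM_component[of J "\<lambda>_. std_normal_distribution" j] prob_space_std_normal assms that
      by simp
  qed
  have "distr ?M (\<Pi>\<^sub>M j\<in>J. borel) (\<lambda>\<omega>. \<lambda>j\<in>J. \<omega> j) = distr ?M ?M (\<lambda>\<omega>. \<omega>)"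
    by (rule distr_cong) (auto simp: space_PiM intro!: sets_PiM_cong PiE_restrict)
  also have "\<dots> = ?M" by (rule distr_id)
  also have "\<dots> = (\<Pi>\<^sub>M j\<in>J. distr ?M borel (\<lambda>\<omega>. \<omega> j))"
    by (intro PiM_cong) (auto simp: comp)
  finally show ?thesis
    using indep_vars_iff_distr_eq_PiM'[OF False, where M' = "\<lambda>_. borel" and X = "\<lambda>j \<omega>. \<omega> j"] rv
    by simp
qed

lemma distributed_weighted_sum:
  assumes J: "finite J" "B \<subseteq> J" and s: "(\<Sum>j\<in>B. (c j)\<^sup>2) = s\<^sup>2" "s > 0"
  shows "distributed (\<Pi>\<^sub>M j\<in>J. std_normal_distribution) lborel (\<lambda>\<omega>. \<Sum>j\<in>B. c j * \<omega> j) (normal_density 0 s)"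
proof -
  let ?M = "\<Pi>\<^sub>M j\<in>J. std_normal_distribution"
  interpret prob_space ?M by (intro prob_space_PiM prob_space_std_normal)
  \<comment> \<open>A coordinate of weight zero would contribute a degenerate normal variable without a density.\<close>
  define B' where "B' = {j\<in>B. c j \<noteq> 0}"
  have fin: "finite B" "finite B'" using J by (auto simp: B'_def dest: finite_subset)
  have s': "(\<Sum>j\<in>B'. (c j)\<^sup>2) = s\<^sup>2"
    unfolding s(1)[symmetric] B'_def using fin by (intro sum.mono_neutral_left) auto
  have ne: "B' \<noteq> {}" using s s' by auto
  have BJ: "j \<in> J" if "j \<in> B'" for j using that J by (auto simp: B'_def)
  have ind: "indep_vars (\<lambda>_. borel) (\<lambda>j \<omega>. c j * \<omega> j) B'"
    using indep_vars_compose2[OF indep_vars_subset[OF indep_coordinates[OF J(1)], of B'],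
        of "\<lambda>j x. c j * x" "\<lambda>_. borel"] BJ by auto
  have norm: "distributed ?M lborel (\<lambda>\<omega>. c j * \<omega> j) (normal_density 0 \<bar>c j\<bar>)" if "j \<in> B'" for j
  proof -
    have "distr ?M lborel (\<lambda>\<omega>. \<omega> j) = distr ?M std_normal_distribution (\<lambda>\<omega>. \<omega> j)"
      by (rule distr_cong) auto
    also have "\<dots> = std_normal_distribution"
      using distr_PiM_component[of J "\<lambda>_. std_normal_distribution" j] prob_space_std_normal J(1) BJ[OF that] by simp
    finally have "distributed ?M lborel (\<lambda>\<omega>. \<omega> j) std_normal_density"
      unfolding distributed_def
      using measurable_component_singleton[OF BJ[OF that], of "\<lambda>_. std_normal_distribution"] by simp
    from normal_density_affine[OF this, of "c j" 0] that show ?thesis by (simp add: B'_def)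
  qed
  have "distributed ?M lborel (\<lambda>\<omega>. \<Sum>j\<in>B'. c j * \<omega> j)
      (normal_density (\<Sum>j\<in>B'. 0) (sqrt (\<Sum>j\<in>B'. \<bar>c j\<bar>\<^sup>2)))"
    by (rule sum_indep_normal[OF fin(2) ne ind _ norm]) (auto simp: B'_def)
  moreover have "sqrt (\<Sum>j\<in>B'. \<bar>c j\<bar>\<^sup>2) = s" using s s' by simp
  moreover have "(\<Sum>j\<in>B'. c j * \<omega> j) = (\<Sum>j\<in>B. c j * \<omega> j)" for \<omega> :: "'a \<Rightarrow> real"
    unfolding B'_def using fin by (intro sum.mono_neutral_left) auto
  ultimately show ?thesis by simp
qed

text \<open>Sums over disjoint blocks of independent normal variables are independent. With the rows of the noise matrix
  as blocks this covers the form of \<open>W\<^sup>T W - p I\<close> at a fixed vector, with its columns the squared norm of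
  \<open>W\<^sup>T \<theta>\<close>.\<close>

lemma block_squares_mgf:
  fixes B :: "'l \<Rightarrow> 'j set" and c :: "'j \<Rightarrow> real"
  assumes J: "finite J" and L: "finite L" and B: "\<And>l. l \<in> L \<Longrightarrow> B l \<subseteq> J" and disj: "disjoint_family_on B L"
    and s: "\<And>l. l \<in> L \<Longrightarrow> (\<Sum>j\<in>B l. (c j)\<^sup>2) = s\<^sup>2" "s > 0" and lam: "\<bar>lam * s\<^sup>2\<bar> \<le> 1/4"
  shows "integrable (\<Pi>\<^sub>M j\<in>J. std_normal_distribution)
      (\<lambda>\<omega>. exp (lam * (\<Sum>l\<in>L. (\<Sum>j\<in>B l. c j * \<omega> j)\<^sup>2 - s\<^sup>2)))"
    and "(\<integral>\<omega>. exp (lam * (\<Sum>l\<in>L. (\<Sum>j\<in>B l. c j * \<omega> j)\<^sup>2 - s\<^sup>2)) \<partial>(\<Pi>\<^sub>M j\<in>J. std_normal_distribution))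
      \<le> exp (4 * lam\<^sup>2 * s ^ 4 * real (card L))"
proof -
  let ?M = "\<Pi>\<^sub>M j\<in>J. std_normal_distribution"
  interpret prob_space ?M by (intro prob_space_PiM prob_space_std_normal)
  let ?X = "\<lambda>l \<omega>. exp (lam * ((\<Sum>j\<in>B l. c j * \<omega> j)\<^sup>2 - s\<^sup>2))"
  have eq: "exp (lam * (\<Sum>l\<in>L. (\<Sum>j\<in>B l. c j * \<omega> j)\<^sup>2 - s\<^sup>2)) = (\<Prod>l\<in>L. ?X l \<omega>)" for \<omega>
    using L by (simp add: sum_distrib_left exp_sum)
  have ind: "indep_vars (\<lambda>_. borel) ?X L"
  proof -
    have "indep_vars (\<lambda>_. borel) (\<lambda>l \<omega>. (\<lambda>z. exp (lam * ((\<Sum>j\<in>B l. c j * z j)\<^sup>2 - s\<^sup>2))) (restrict (\<lambda>j. \<omega> j) (B l))) L"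
      by (rule indep_vars_compose2[OF indep_vars_restrict[OF indep_coordinates[OF J] B disj]])
        (auto intro!: borel_measurable_exp borel_measurable_times borel_measurable_diff borel_measurable_power
          borel_measurable_sum measurable_component_singleton)
    then show ?thesis by simp
  qed
  have int: "integrable ?M (?X l)" and le: "expectation (?X l) \<le> exp (4 * lam\<^sup>2 * s ^ 4)" if "l \<in> L" for l
    using normal_square_mgf[OF distributed_weighted_sum[OF J B[OF that] s(1)[OF that] s(2)] s(2) lam] by auto
  show "integrable ?M (\<lambda>\<omega>. exp (lam * (\<Sum>l\<in>L. (\<Sum>j\<in>B l. c j * \<omega> j)\<^sup>2 - s\<^sup>2)))"
    unfolding eq by (rule indep_vars_integrable[OF L ind int])
  have "expectation (\<lambda>\<omega>. \<Prod>l\<in>L. ?X l \<omega>) = (\<Prod>l\<in>L. expectation (?X l))"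
    by (rule indep_vars_lebesgue_integral[OF L ind int])
  also have "\<dots> \<le> (\<Prod>l\<in>L. exp (4 * lam\<^sup>2 * s ^ 4))"
    by (intro prod_mono conjI le integral_nonneg_AE) auto
  also have "\<dots> = exp (4 * lam\<^sup>2 * s ^ 4 * real (card L))"
    by (simp add: exp_of_nat_mult[symmetric] mult.commute)
  finally show "expectation (\<lambda>\<omega>. exp (lam * (\<Sum>l\<in>L. (\<Sum>j\<in>B l. c j * \<omega> j)\<^sup>2 - s\<^sup>2)))
      \<le> exp (4 * lam\<^sup>2 * s ^ 4 * real (card L))" unfolding eq .
qed

section \<open>A finite net for the unit ball\<close>

text \<open>The points of the grid of mesh \<open>1 / (4 \<surd>n)\<close> in the unit ball, given by their integer coordinates. The range
  \<open>-16 n..16 n\<close> follows from the bound on the sum of squares and makes finiteness evident.\<close>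

definition net ::"nat \<Rightarrow> (nat \<Rightarrow> int) set" where
  "net n = {k \<in> {..<n} \<rightarrow>\<^sub>E {-16 * int n..16 * int n}. (\<Sum>i<n. (k i)\<^sup>2) \<le> 16 * int n}"

definition net_point :: "nat \<Rightarrow> (nat \<Rightarrow> int) \<Rightarrow> nat \<Rightarrow> real" where
  "net_point n k i = real_of_int (k i) / (4 * sqrt (real n))"

lemma finite_net [simp]: "finite (net n)"
proof -
  have "finite ({..<n} \<rightarrow>\<^sub>E {-16 * int n..16 * int n})" by (intro finite_PiE) auto
  then show ?thesis unfolding net_def by simp
qed

lemma sum_half_powers_le: "(\<Sum>z\<in>{- int m..int m}. (1/2::real) ^ nat \<bar>z\<bar>) \<le> 3 - 2 * (1/2) ^ m"
proof (induction m)
  case (Suc m)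
  have eq: "{- int (Suc m)..int (Suc m)} = insert (- int (Suc m)) (insert (int (Suc m)) {- int m..int m})"
    by auto
  have "(\<Sum>z\<in>{- int (Suc m)..int (Suc m)}. (1/2::real) ^ nat \<bar>z\<bar>)
      = (1/2) ^ Suc m + ((1/2) ^ Suc m + (\<Sum>z\<in>{- int m..int m}. (1/2::real) ^ nat \<bar>z\<bar>))"
    unfolding eq by (subst sum.insert, simp, simp)+ (simp add: nat_add_distrib)
  then show ?case using Suc by simp
qed simp

lemma abs_le_square_int: "\<bar>z\<bar> \<le> z\<^sup>2" for z :: int
  using mult_left_mono[of 1 "\<bar>z\<bar>" "\<bar>z\<bar>"]
  by (cases "z = 0") (auto simp: power2_eq_square abs_mult_self_eq)

text \<open>The number of integer points is bounded by an exponential Chebyshev inequality: every point of the net satisfies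
  \<open>\<Sum> \<bar>k\<^sub>i\<bar> \<le> \<Sum> k\<^sub>i\<^sup>2 \<le> 16 n\<close> and therefore has weight at least 1 under \<open>2 ^ (16 n) \<Prod> (1/2) ^ \<bar>k\<^sub>i\<bar>\<close>, and the total weight of all
  integer points factorises over the coordinates.\<close>

lemma card_net_le: "real (card (net n)) \<le> exp (18 * real n)"
proof -
  let ?P = "{..<n} \<rightarrow>\<^sub>E {-16 * int n..16 * int n}"
  have fin: "finite ?P" by (intro finite_PiE) auto
  have one: "1 \<le> 2 ^ (16 * n) * (\<Prod>i<n. (1/2::real) ^ nat \<bar>k i\<bar>)" if "k \<in> net n" for k
  proof -
    have "(\<Sum>i<n. \<bar>k i\<bar>) \<le> (\<Sum>i<n. (k i)\<^sup>2)"
      by (intro sum_mono abs_le_square_int)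
    also have "\<dots> \<le> 16 * int n" using that by (simp add: net_def)
    finally have "(\<Sum>i<n. \<bar>k i\<bar>) \<le> 16 * int n" .
    moreover have "int (\<Sum>i<n. nat \<bar>k i\<bar>) = (\<Sum>i<n. \<bar>k i\<bar>)" by simp
    ultimately have le: "(\<Sum>i<n. nat \<bar>k i\<bar>) \<le> 16 * n" by linarith
    have "(\<Prod>i<n. (1/2::real) ^ nat \<bar>k i\<bar>) = (1/2) ^ (\<Sum>i<n. nat \<bar>k i\<bar>)" by (simp add: power_sum)
    also have "\<dots> \<ge> (1/2) ^ (16 * n)" by (rule power_decreasing[OF le]) auto
    finally have "2 ^ (16 * n) * (1/2) ^ (16 * n) \<le> 2 ^ (16 * n) * (\<Prod>i<n. (1/2::real) ^ nat \<bar>k i\<bar>)"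
      by (intro mult_left_mono) auto
    then show ?thesis by (simp add: power_mult_distrib[symmetric])
  qed
  have "real (card (net n)) = (\<Sum>k\<in>net n. 1)" by simp
  also have "\<dots> \<le> (\<Sum>k\<in>net n. 2 ^ (16 * n) * (\<Prod>i<n. (1/2::real) ^ nat \<bar>k i\<bar>))"
    by (intro sum_mono one)
  also have "\<dots> \<le> (\<Sum>k\<in>?P. 2 ^ (16 * n) * (\<Prod>i<n. (1/2::real) ^ nat \<bar>k i\<bar>))"
  proof (rule sum_mono2[OF fin])
    show "net n \<subseteq> ?P" by (simp only: net_def) blast
    show "0 \<le> 2 ^ (16 * n) * (\<Prod>i<n. (1/2::real) ^ nat \<bar>k i\<bar>)" for k :: "nat \<Rightarrow> int"
      by (intro mult_nonneg_nonneg prod_nonneg) simp_all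
  qed
  also have "\<dots> = 2 ^ (16 * n) * (\<Sum>k\<in>?P. \<Prod>i<n. (1/2::real) ^ nat \<bar>k i\<bar>)"
    by (simp only: sum_distrib_left)
  also have "\<dots> = 2 ^ (16 * n) * (\<Prod>i<n. \<Sum>z\<in>{-16 * int n..16 * int n}. (1/2::real) ^ nat \<bar>z\<bar>)"
    by (subst prod_sum_PiE) simp_all
  also have "\<dots> \<le> 2 ^ (16 * n) * (\<Prod>i<n. 3)"
  proof (intro mult_left_mono prod_mono conjI)
    have "(\<Sum>z\<in>{-16 * int n..16 * int n}. (1/2::real) ^ nat \<bar>z\<bar>) \<le> 3 - 2 * (1/2) ^ (16 * n)"
      using sum_half_powers_le[of "16 * n"] by simp
    also have "\<dots> \<le> 3" by simp
    finally show "(\<Sum>z\<in>{-16 * int n..16 * int n}. (1/2::real) ^ nat \<bar>z\<bar>) \<le> 3" .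
  qed (auto intro!: sum_nonneg)
  also have "\<dots> = (2 ^ 16 * 3) ^ n" by (simp add: power_mult power_mult_distrib[symmetric])
  also have "\<dots> \<le> (exp 18) ^ n"
  proof (rule power_mono)
    have "(2::real) ^ 18 \<le> exp 1 ^ 18" by (intro power_mono exp_ge_add_one_self[of 1, simplified]) auto
    also have "\<dots> = exp 18" by (simp add: exp_of_nat_mult[symmetric])
    finally show "2 ^ 16 * 3 \<le> exp (18::real)" by simp
  qed simp
  also have "\<dots> = exp (18 * real n)" by (simp add: exp_of_nat_mult[symmetric] mult.commute)
  finally show ?thesis .
qed

lemma sqnorm_net_point_le:
  assumes "n > 0" "k \<in> net n"
  shows "sqnorm n (net_point n k) \<le> 1"
proof -
  have "sqnorm n (net_point n k) = real_of_int (\<Sum>i<n. (k i)\<^sup>2) / (16 * real n)"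
    using assms by (simp add: sqnorm_def net_point_def power_divide power_mult_distrib sum_divide_distrib)
  also have "\<dots> \<le> real_of_int (16 * int n) / (16 * real n)"
  proof (rule divide_right_mono)
    have "(\<Sum>i<n. (k i)\<^sup>2) \<le> 16 * int n" using assms by (simp add: net_def)
    then show "real_of_int (\<Sum>i<n. (k i)\<^sup>2) \<le> real_of_int (16 * int n)" by (simp only: of_int_le_iff)
  qed simp
  finally show ?thesis using assms by simp
qed

lemma net_approximates:
  assumes n: "n > 0" and x: "sqnorm n x \<le> 1"
  shows "\<exists>k\<in>net n. sqnorm n (\<lambda>i. x i - net_point n k i) \<le> 1/16 \<and> sqnorm n (\<lambda>i. x i + net_point n k i) \<le> 4"
proof -
  define c where "c = 4 * sqrt (real n)"
  have c: "c > 0" "c\<^sup>2 = 16 * real n" using n by (auto simp: c_def power_mult_distrib)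
  define r where "r = (\<lambda>a::real. if a \<ge> 0 then \<lfloor>a\<rfloor> else - \<lfloor>- a\<rfloor>)"
  \<comment> \<open>Rounding towards zero keeps the point inside the ball.\<close>
  have r: "\<bar>real_of_int (r a)\<bar> \<le> \<bar>a\<bar>" "\<bar>a - real_of_int (r a)\<bar> \<le> 1" for a
  proof -
    have "\<bar>real_of_int (r a)\<bar> \<le> \<bar>a\<bar> \<and> \<bar>a - real_of_int (r a)\<bar> \<le> 1"
    proof (cases "a \<ge> 0")
      case True
      then have "0 \<le> real_of_int \<lfloor>a\<rfloor>" "r a = \<lfloor>a\<rfloor>" by (simp_all add: r_def)
      moreover have "real_of_int \<lfloor>a\<rfloor> \<le> a" "a \<le> real_of_int \<lfloor>a\<rfloor> + 1" by simp_all
      ultimately show ?thesis by (simp only: abs_le_iff) linarith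
    next
      case False
      then have "0 \<le> real_of_int \<lfloor>- a\<rfloor>" "r a = - \<lfloor>- a\<rfloor>" by (simp_all add: r_def)
      moreover have "real_of_int \<lfloor>- a\<rfloor> \<le> - a" "- a \<le> real_of_int \<lfloor>- a\<rfloor> + 1"
        by (rule of_int_floor_le, rule real_of_int_floor_add_one_ge)
      ultimately show ?thesis by (simp only: abs_le_iff of_int_minus) linarith
    qed
    then show "\<bar>real_of_int (r a)\<bar> \<le> \<bar>a\<bar>" "\<bar>a - real_of_int (r a)\<bar> \<le> 1" by auto
  qed
  define k where "k = (\<lambda>i\<in>{..<n}. r (c * x i))"
  have y: "net_point n k i = real_of_int (r (c * x i)) / c" if "i < n" for i
    using that by (simp add: net_point_def k_def c_def)
  have y1: "\<bar>net_point n k i\<bar> \<le> \<bar>x i\<bar>" and y2: "\<bar>x i - net_point n k i\<bar> \<le> 1 / c" if "i < n" for i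
  proof -
    show "\<bar>net_point n k i\<bar> \<le> \<bar>x i\<bar>"
      using r(1)[of "c * x i"] c(1) by (simp add: y[OF that] abs_mult field_simps)
    have "x i - net_point n k i = (c * x i - real_of_int (r (c * x i))) / c"
      using c(1) by (simp add: y[OF that] diff_divide_distrib)
    then show "\<bar>x i - net_point n k i\<bar> \<le> 1 / c"
      using r(2)[of "c * x i"] c(1) by (simp add: divide_right_mono)
  qed
  have "real_of_int (\<Sum>i<n. (k i)\<^sup>2) = c\<^sup>2 * sqnorm n (net_point n k)"
    unfolding sqnorm_def sum_distrib_left using c(1)
    by (simp add: net_point_def c_def power_divide)
  also have "\<dots> \<le> c\<^sup>2 * sqnorm n x"
    unfolding sqnorm_def using y1 by (intro mult_left_mono sum_mono) (auto simp: abs_le_square_iff)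
  also have "\<dots> \<le> c\<^sup>2 * 1" using x by (intro mult_left_mono) auto
  also have "\<dots> = real_of_int (16 * int n)" using c by simp
  finally have sum: "(\<Sum>i<n. (k i)\<^sup>2) \<le> 16 * int n" by (simp only: of_int_le_iff)
  have "k i \<in> {-16 * int n..16 * int n}" if "i < n" for i
  proof -
    have "\<bar>k i\<bar> \<le> (k i)\<^sup>2" by (rule abs_le_square_int)
    also have "\<dots> \<le> (\<Sum>i<n. (k i)\<^sup>2)" by (rule member_le_sum) (use that in auto)
    finally show ?thesis using sum by auto
  qed
  then have kn: "k \<in> net n" using sum by (auto simp: net_def k_def)
  have "sqnorm n (\<lambda>i. x i - net_point n k i) \<le> (\<Sum>i<n. (1 / c)\<^sup>2)"
    unfolding sqnorm_def using y2 c(1) by (intro sum_mono) (auto simp: abs_le_square_iff[symmetric])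
  also have "\<dots> = 1/16" using n by (simp add: power_divide c)
  finally have 1: "sqnorm n (\<lambda>i. x i - net_point n k i) \<le> 1/16" .
  have "sqnorm n (\<lambda>i. x i + net_point n k i) \<le> (\<Sum>i<n. (2 * x i)\<^sup>2)"
    unfolding sqnorm_def
  proof (rule sum_mono)
    fix i assume "i \<in> {..<n}"
    then have "\<bar>x i + net_point n k i\<bar> \<le> \<bar>2 * x i\<bar>" using y1[of i] by auto
    then show "(x i + net_point n k i)\<^sup>2 \<le> (2 * x i)\<^sup>2" by (simp only: abs_le_square_iff)
  qed
  also have "\<dots> = 4 * sqnorm n x" by (simp add: sqnorm_def sum_distrib_left)
  finally have "sqnorm n (\<lambda>i. x i + net_point n k i) \<le> 4" using x by simp
  with 1 kn show ?thesis by blast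
qed

text \<open>If \<open>K\<close> bounds the form, passing from a unit vector to a net point within distance \<open>1/4\<close> changes the value by at
  most \<open>K / 2\<close>, so \<open>m + K / 2\<close> is a bound as well. Iterating this contraction from any finite bound leads to its
  fixed point \<open>2 m\<close>.\<close>

lemma form_bounded_by_net:
  assumes n: "n > 0" and sym: "\<And>i j. i < n \<Longrightarrow> j < n \<Longrightarrow> A i j = A j i"
    and m: "\<And>k. k \<in> net n \<Longrightarrow> \<bar>bform n A (net_point n k) (net_point n k)\<bar> \<le> m"
  shows "form_bounded n A (2 * m)"
proof -
  have step: "form_bounded n A (m + K / 2)" if K: "form_bounded n A K" "K \<ge> 0" for K
    unfolding form_bounded_def
  proof
    fix x
    show "\<bar>bform n A x x\<bar> \<le> (m + K / 2) * sqnorm n x"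
    proof (cases "sqnorm n x = 0")
      case True
      then show ?thesis using K(1) unfolding form_bounded_def by (metis mult_zero_right)
    next
      case False
      then have pos: "sqnorm n x > 0" using sqnorm_nonneg[of n x] by (simp add: less_le)
      define y where "y = (\<lambda>i. (1 / sqrt (sqnorm n x)) * x i)"
      have "sqnorm n y = 1" unfolding y_def sqnorm_scale using pos by (simp add: power_divide)
      then obtain k where k: "k \<in> net n" "sqnorm n (\<lambda>i. y i - net_point n k i) \<le> 1/16"
          "sqnorm n (\<lambda>i. y i + net_point n k i) \<le> 4"
        using net_approximates[OF n, of y] by auto
      have "\<bar>bform n A y y - bform n A (net_point n k) (net_point n k)\<bar>
          \<le> K / 2 * (8 * sqnorm n (\<lambda>i. y i - net_point n k i) + sqnorm n (\<lambda>i. y i + net_point n k i) / 8)"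
        by (rule form_bounded_diff[OF K(1) sym]) auto
      also have "\<dots> \<le> K / 2 * (8 * (1/16) + 4 / 8)"
        using k K(2) by (intro mult_left_mono add_mono divide_right_mono) auto
      also have "\<dots> = K / 2" by simp
      finally have "\<bar>bform n A y y\<bar> \<le> m + K / 2" using m[OF k(1)] by linarith
      moreover have "bform n A y y = bform n A x x / sqnorm n x"
        unfolding y_def bform_scale_left bform_scale_right using pos by simp
      ultimately show ?thesis using pos by (simp add: field_simps)
    qed
  qed
  obtain K where K: "K \<ge> 0" "form_bounded n A K" using form_bounded_Frobenius by blast
  have "(\<lambda>_. 0) \<in> {..<n} \<rightarrow> {-16 * int n..16 * int n}" by auto
  then have "(\<lambda>i\<in>{..<n}. 0) \<in> net n" by (auto simp: net_def)
  from m[OF this] have m0: "m \<ge> 0" by linarith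
  have iter: "form_bounded n A (2 * m + K * (1/2) ^ j)" for j
  proof (induction j)
    case 0
    show ?case unfolding form_bounded_def
    proof
      fix x
      have "\<bar>bform n A x x\<bar> \<le> K * sqnorm n x" using K(2) by (simp add: form_bounded_def)
      also have "\<dots> \<le> (2 * m + K * (1/2) ^ 0) * sqnorm n x" using m0 by (intro mult_right_mono) auto
      finally show "\<bar>bform n A x x\<bar> \<le> (2 * m + K * (1/2) ^ 0) * sqnorm n x" .
    qed
  next
    case (Suc j)
    have "m + (2 * m + K * (1/2) ^ j) / 2 = 2 * m + K * (1/2) ^ Suc j" by simp
    moreover have "form_bounded n A (m + (2 * m + K * (1/2) ^ j) / 2)"
      by (rule step[OF Suc]) (use m0 K(1) in simp)
    ultimately show ?case by (simp only:)
  qed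
  show ?thesis unfolding form_bounded_def
  proof
    fix x
    have "(\<lambda>j. (2 * m + K * (1/2) ^ j) * sqnorm n x) \<longlonglongrightarrow> (2 * m + K * 0) * sqnorm n x"
      by (intro tendsto_intros LIMSEQ_realpow_zero) auto
    moreover have "\<bar>bform n A x x\<bar> \<le> (2 * m + K * (1/2) ^ j) * sqnorm n x" for j
      using iter[of j] by (simp add: form_bounded_def)
    ultimately show "\<bar>bform n A x x\<bar> \<le> 2 * m * sqnorm n x"
      using LIMSEQ_le_const[of "\<lambda>j. (2 * m + K * (1/2) ^ j) * sqnorm n x"] by simp
  qed
qed

section \<open>Size of the noise\<close>

lemma bform_noise_gram:
  "bform n (noise_gram p \<omega>) y y = (\<Sum>k<p. (\<Sum>i<n. y i * \<omega> (k, i))\<^sup>2 - sqnorm n y)"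
proof -
  have "bform n (\<lambda>i j. \<Sum>k<p. \<omega> (k, i) * \<omega> (k, j)) y y = (\<Sum>k<p. bform n (\<lambda>i j. \<omega> (k, i) * \<omega> (k, j)) y y)"
    unfolding bform_def sum_distrib_right
    by (subst sum.swap[of _ "{..<p}"]) (intro sum.cong refl sum.swap)
  also have "\<dots> = (\<Sum>k<p. (\<Sum>i<n. y i * \<omega> (k, i))\<^sup>2)"
    unfolding bform_rank_one by (simp add: power2_eq_square mult.commute)
  finally have 1: "bform n (\<lambda>i j. \<Sum>k<p. \<omega> (k, i) * \<omega> (k, j)) y y = (\<Sum>k<p. (\<Sum>i<n. y i * \<omega> (k, i))\<^sup>2)" .
  have "bform n (noise_gram p \<omega>) y y
      = bform n (\<lambda>i j. (\<Sum>k<p. \<omega> (k, i) * \<omega> (k, j)) + (-1) * (if i = j then real p else 0)) y y"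
    by (intro bform_cong) (auto simp: noise_gram_def)
  also have "\<dots> = (\<Sum>k<p. (\<Sum>i<n. y i * \<omega> (k, i))\<^sup>2) - (\<Sum>i<n. real p * (y i)\<^sup>2)"
    unfolding bform_mat_add bform_mat_scale bform_diag 1 by simp
  finally show ?thesis by (simp add: sum_subtractf sqnorm_def sum_distrib_left)
qed

text \<open>An exponential sum in place of the maximum of the form over the net: its logarithm divided by \<open>lam\<close>
  dominates the maximum, while its mean is a sum of moment generating functions.\<close>

definition net_partition :: "nat \<Rightarrow> nat \<Rightarrow> real \<Rightarrow> (nat \<times> nat \<Rightarrow> real) \<Rightarrow> real" where
  "net_partition p n lam \<omega> = (\<Sum>k\<in>net n. exp (lam * bform n (noise_gram p \<omega>) (net_point n k) (net_point n k))
     + exp (- lam * bform n (noise_gram p \<omega>) (net_point n k) (net_point n k)))"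

lemma net_partition_bounds:
  assumes n: "n > 0" and lam: "lam > 0"
  shows "net_partition p n lam \<omega> > 1"
    and "form_bounded n (noise_gram p \<omega>) (2 * ln (net_partition p n lam \<omega>) / lam)"
proof -
  let ?Q = "\<lambda>k. bform n (noise_gram p \<omega>) (net_point n k) (net_point n k)"
  let ?Z = "net_partition p n lam \<omega>"
  have le: "exp (lam * \<bar>?Q k\<bar>) < ?Z" if "k \<in> net n" for k
  proof -
    have "exp (lam * \<bar>?Q k\<bar>) < exp (lam * ?Q k) + exp (- lam * ?Q k)"
      by (cases "?Q k \<ge> 0") simp_all
    also have "\<dots> \<le> ?Z"
      unfolding net_partition_def using that
      by (intro member_le_sum[of k "net n" "\<lambda>k. exp (lam * ?Q k) + exp (- lam * ?Q k)"]) (auto intro: add_nonneg_nonneg)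
    finally show ?thesis .
  qed
  have "(\<lambda>i\<in>{..<n}. 0) \<in> net n" by (auto simp: net_def)
  then have "exp (lam * \<bar>?Q (\<lambda>i\<in>{..<n}. 0)\<bar>) < ?Z" by (rule le)
  moreover have "1 \<le> exp (lam * \<bar>?Q (\<lambda>i\<in>{..<n}. 0)\<bar>)" using lam by simp
  ultimately show Z: "?Z > 1" by (rule le_less_trans[rotated])
  have "form_bounded n (noise_gram p \<omega>) (2 * (ln ?Z / lam))"
  proof (rule form_bounded_by_net[OF n])
    fix k assume "k \<in> net n"
    then have "lam * \<bar>?Q k\<bar> \<le> ln ?Z" using le[of k] Z by (subst ln_ge_iff) auto
    then show "\<bar>?Q k\<bar> \<le> ln ?Z / lam" using lam by (simp add: field_simps)
  qed (auto simp: noise_gram_def mult.commute)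
  then show "form_bounded n (noise_gram p \<omega>) (2 * ln ?Z / lam)" by simp
qed

lemma noise_gram_form_mgf:
  assumes lam: "\<bar>lam\<bar> \<le> 1/4" and y: "sqnorm n y \<le> 1"
  shows "integrable (noise p n) (\<lambda>\<omega>. exp (lam * bform n (noise_gram p \<omega>) y y))"
    and "(\<integral>\<omega>. exp (lam * bform n (noise_gram p \<omega>) y y) \<partial>noise p n) \<le> exp (4 * real p * lam\<^sup>2)"
proof -
  interpret prob_space "noise p n"
    unfolding noise_def by (intro prob_space_PiM prob_space_std_normal)
  have "integrable (noise p n) (\<lambda>\<omega>. exp (lam * bform n (noise_gram p \<omega>) y y))
    \<and> (\<integral>\<omega>. exp (lam * bform n (noise_gram p \<omega>) y y) \<partial>noise p n) \<le> exp (4 * real p * lam\<^sup>2)"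
  proof (cases "sqnorm n y = 0")
    case True
    then have "y i = 0" if "i < n" for i using sqnorm_eq_0D that by blast
    then have "bform n (noise_gram p \<omega>) y y = 0" for \<omega> by (simp add: bform_def)
    then show ?thesis by (simp add: prob_space)
  next
    case False
    then have pos: "sqnorm n y > 0" using sqnorm_nonneg[of n y] by (simp add: less_le)
    define s where "s = sqrt (sqnorm n y)"
    have s: "s > 0" "s\<^sup>2 = sqnorm n y" using pos by (auto simp: s_def)
    let ?B = "\<lambda>k::nat. {k} \<times> {..<n}"
    have row: "(\<Sum>j\<in>?B k. f j) = (\<Sum>i<n. f (k, i))" for k :: nat and f :: "nat \<times> nat \<Rightarrow> real"
      by (rule sum.reindex_bij_witness[of _ "\<lambda>i. (k, i)" snd]) auto
    have lams: "\<bar>lam * s\<^sup>2\<bar> \<le> 1/4"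
    proof -
      have "\<bar>lam * s\<^sup>2\<bar> \<le> \<bar>lam\<bar> * 1" unfolding abs_mult using y by (intro mult_left_mono) (auto simp: s)
      then show ?thesis using lam by simp
    qed
    have sums: "(\<Sum>j\<in>?B k. (y (snd j))\<^sup>2) = s\<^sup>2" for k by (simp add: row s sqnorm_def)
    have eq: "(\<Sum>k<p. (\<Sum>j\<in>?B k. y (snd j) * \<omega> j)\<^sup>2 - s\<^sup>2) = bform n (noise_gram p \<omega>) y y" for \<omega>
      by (simp add: row s bform_noise_gram)
    have disj: "disjoint_family_on ?B {..<p}" by (auto simp: disjoint_family_on_def)
    have "finite (mat_indices p n)" by (simp add: mat_indices_def)
    note mgf = block_squares_mgf[OF this finite_lessThan _ disj sums s(1) lams, unfolded eq, folded noise_def]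
    have sub: "?B k \<subseteq> mat_indices p n" if "k \<in> {..<p}" for k using that by (auto simp: mat_indices_def)
    have "4 * lam\<^sup>2 * s ^ 4 * real (card {..<p}) \<le> 4 * real p * lam\<^sup>2"
    proof -
      have "s ^ 4 = (s\<^sup>2)\<^sup>2" by simp
      also have "\<dots> \<le> 1" using y by (simp only: s power_le_one sqnorm_nonneg)
      finally have "4 * lam\<^sup>2 * real p * s ^ 4 \<le> 4 * lam\<^sup>2 * real p * 1" by (intro mult_left_mono) auto
      then show ?thesis by (simp add: mult_ac)
    qed
    then have "exp (4 * lam\<^sup>2 * s ^ 4 * real (card {..<p})) \<le> exp (4 * real p * lam\<^sup>2)" by simp
    with mgf[OF sub] show ?thesis by (meson order.trans)
  qed
  then show "integrable (noise p n) (\<lambda>\<omega>. exp (lam * bform n (noise_gram p \<omega>) y y))"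
    and "(\<integral>\<omega>. exp (lam * bform n (noise_gram p \<omega>) y y) \<partial>noise p n) \<le> exp (4 * real p * lam\<^sup>2)" by auto
qed

lemma net_partition_mean:
  assumes n: "n > 0" and lam: "\<bar>lam\<bar> \<le> 1/4"
  shows "integrable (noise p n) (net_partition p n lam)"
    and "(\<integral>\<omega>. net_partition p n lam \<omega> \<partial>noise p n) \<le> exp (20 * real n + 4 * real p * lam\<^sup>2)"
proof -
  let ?Q = "\<lambda>k \<omega>. bform n (noise_gram p \<omega>) (net_point n k) (net_point n k)"
  have lam': "\<bar>- lam\<bar> \<le> 1/4" using lam by simp
  note mgf = noise_gram_form_mgf[OF lam sqnorm_net_point_le[OF n], where p = p]
    noise_gram_form_mgf[OF lam' sqnorm_net_point_le[OF n], where p = p]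
  show "integrable (noise p n) (net_partition p n lam)"
    unfolding net_partition_def[abs_def] by (intro Bochner_Integration.integrable_sum Bochner_Integration.integrable_add mgf)
  have "(\<integral>\<omega>. net_partition p n lam \<omega> \<partial>noise p n)
      = (\<Sum>k\<in>net n. (\<integral>\<omega>. exp (lam * ?Q k \<omega>) \<partial>noise p n) + (\<integral>\<omega>. exp (- lam * ?Q k \<omega>) \<partial>noise p n))"
    unfolding net_partition_def
    by (subst Bochner_Integration.integral_sum, intro Bochner_Integration.integrable_add mgf, assumption+)
      (intro sum.cong refl Bochner_Integration.integral_add mgf)
  also have "\<dots> \<le> (\<Sum>k\<in>net n. exp (4 * real p * lam\<^sup>2) + exp (4 * real p * (- lam)\<^sup>2))"
    by (intro sum_mono add_mono mgf)
  also have "\<dots> = real (card (net n)) * 2 * exp (4 * real p * lam\<^sup>2)" by simp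
  also have "\<dots> \<le> exp (18 * real n) * exp (2 * real n) * exp (4 * real p * lam\<^sup>2)"
  proof (intro mult_right_mono mult_mono card_net_le)
    have "2 \<le> 1 + 2 * real n" using n by simp
    also have "\<dots> \<le> exp (2 * real n)" by (rule exp_ge_add_one_self)
    finally show "2 \<le> exp (2 * real n)" .
  qed auto
  also have "\<dots> = exp (20 * real n + 4 * real p * lam\<^sup>2)" by (simp add: exp_add[symmetric])
  finally show "(\<integral>\<omega>. net_partition p n lam \<omega> \<partial>noise p n) \<le> exp (20 * real n + 4 * real p * lam\<^sup>2)" .
qed

lemma projection_mgf:
  assumes \<tau>: "\<tau> = (\<Sum>k<p. (\<theta> $ k)\<^sup>2)" "\<tau> > 0"
  shows "integrable (noise p n) (\<lambda>\<omega>. exp (sqnorm n (noise_projection p \<theta> \<omega>) / \<tau> / 4))"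
    and "(\<integral>\<omega>. exp (sqnorm n (noise_projection p \<theta> \<omega>) / \<tau> / 4) \<partial>noise p n) \<le> exp (real n / 2)"
proof -
  define s where "s = sqrt \<tau>"
  have s: "s > 0" "s\<^sup>2 = \<tau>" using \<tau>(2) by (auto simp: s_def)
  let ?B = "\<lambda>i::nat. {..<p} \<times> {i}"
  let ?lam = "1 / (4 * \<tau>)"
  have col: "(\<Sum>j\<in>?B i. f j) = (\<Sum>k<p. f (k, i))" for i :: nat and f :: "nat \<times> nat \<Rightarrow> real"
    by (rule sum.reindex_bij_witness[of _ "\<lambda>k. (k, i)" fst]) auto
  have lams: "\<bar>?lam * s\<^sup>2\<bar> \<le> 1/4" using \<tau>(2) by (simp add: s)
  have sums: "(\<Sum>j\<in>?B k. (\<theta> $ fst j)\<^sup>2) = s\<^sup>2" for k by (simp add: col s \<tau>(1))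
  have eq: "?lam * (\<Sum>i<n. (\<Sum>j\<in>?B i. \<theta> $ fst j * \<omega> j)\<^sup>2 - s\<^sup>2)
      = sqnorm n (noise_projection p \<theta> \<omega>) / \<tau> / 4 - real n / 4" for \<omega>
    using \<tau>(2) by (simp add: col s sqnorm_def noise_projection_def sum_subtractf diff_divide_distrib)
  have disj: "disjoint_family_on ?B {..<n}" by (auto simp: disjoint_family_on_def)
  have fin: "finite (mat_indices p n)" by (simp add: mat_indices_def)
  have sub: "?B i \<subseteq> mat_indices p n" if "i \<in> {..<n}" for i using that by (auto simp: mat_indices_def)
  let ?G = "\<lambda>\<omega>. sqnorm n (noise_projection p \<theta> \<omega>) / \<tau> / 4"
  have i: "integrable (noise p n) (\<lambda>\<omega>. exp (?G \<omega> - real n / 4))"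
    and le: "(\<integral>\<omega>. exp (?G \<omega> - real n / 4) \<partial>noise p n) \<le> exp (4 * ?lam\<^sup>2 * s ^ 4 * real (card {..<n}))"
    using block_squares_mgf[OF fin finite_lessThan sub disj sums s(1) lams] unfolding eq noise_def by auto
  have G: "exp (?G \<omega>) = exp (real n / 4) * exp (?G \<omega> - real n / 4)" for \<omega>
    by (simp add: exp_add[symmetric])
  show "integrable (noise p n) (\<lambda>\<omega>. exp (?G \<omega>))" unfolding G using i by (rule integrable_mult_right)
  have "s ^ 4 = (s\<^sup>2)\<^sup>2" by simp
  then have exponent: "4 * ?lam\<^sup>2 * s ^ 4 * real (card {..<n}) = real n / 4"
    using \<tau>(2) by (simp add: s power_divide power_mult_distrib)
  have le': "(\<integral>\<omega>. exp (?G \<omega> - real n / 4) \<partial>noise p n) \<le> exp (real n / 4)" using le unfolding exponent .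
  have "(\<integral>\<omega>. exp (?G \<omega>) \<partial>noise p n) = exp (real n / 4) * (\<integral>\<omega>. exp (?G \<omega> - real n / 4) \<partial>noise p n)"
    by (subst G) (rule integral_mult_right_zero)
  also have "\<dots> \<le> exp (real n / 4) * exp (real n / 4)" using le' by (intro mult_left_mono) auto
  also have "\<dots> = exp (real n / 2)" by (simp add: exp_add[symmetric])
  finally show "(\<integral>\<omega>. exp (?G \<omega>) \<partial>noise p n) \<le> exp (real n / 2)" .
qed

text \<open>An exponential moment controls the moments and the tail of a logarithm: with \<open>d = ln Z - a\<close> the mean
  of \<open>exp d\<close> is at most 1, and the positive part of \<open>d\<close> and its square are dominated by \<open>exp d\<close>.\<close>

context prob_space
begin

context
  fixes Z :: "'a \<Rightarrow> real" and a :: real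
  assumes Z1: "\<And>\<omega>. 1 \<le> Z \<omega>" and Zint: "integrable M Z" and Za: "expectation Z \<le> exp a" and a: "a \<ge> 0"
begin

lemma mean_scaled_le: "integrable M (\<lambda>\<omega>. Z \<omega> * exp (- a))" "expectation (\<lambda>\<omega>. Z \<omega> * exp (- a)) \<le> 1"
proof -
  show "integrable M (\<lambda>\<omega>. Z \<omega> * exp (- a))" using Zint by simp
  have "expectation (\<lambda>\<omega>. Z \<omega> * exp (- a)) \<le> exp a * exp (- a)"
    using Za by (simp only: integral_mult_left_zero) (intro mult_right_mono, auto)
  then show "expectation (\<lambda>\<omega>. Z \<omega> * exp (- a)) \<le> 1" by (simp add: exp_add[symmetric])
qed

lemma ln_mean: "integrable M (\<lambda>\<omega>. ln (Z \<omega>))" "expectation (\<lambda>\<omega>. ln (Z \<omega>)) \<le> a + 1"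
proof -
  have [measurable]: "Z \<in> borel_measurable M" using Zint by simp
  have le: "ln (Z \<omega>) \<le> a + Z \<omega> * exp (- a)" for \<omega>
  proof -
    have "ln (Z \<omega> * exp (- a)) \<le> Z \<omega> * exp (- a)"
      using Z1[of \<omega>] ln_bound[of "Z \<omega> * exp (- a)"] by simp
    then show ?thesis using Z1[of \<omega>] by (simp add: ln_mult)
  qed
  show i: "integrable M (\<lambda>\<omega>. ln (Z \<omega>))"
  proof (rule Bochner_Integration.integrable_bound[OF Zint])
    have "norm (ln (Z \<omega>)) \<le> norm (Z \<omega>)" for \<omega> using Z1[of \<omega>] ln_bound[of "Z \<omega>"] by simp
    then show "AE \<omega> in M. norm (ln (Z \<omega>)) \<le> norm (Z \<omega>)" by simp
  qed simp
  have "expectation (\<lambda>\<omega>. ln (Z \<omega>)) \<le> expectation (\<lambda>\<omega>. a + Z \<omega> * exp (- a))"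
    using mean_scaled_le(1) by (intro integral_mono i le) simp
  also have "\<dots> = a + expectation (\<lambda>\<omega>. Z \<omega> * exp (- a))"
    using mean_scaled_le(1) by (simp add: prob_space)
  finally show "expectation (\<lambda>\<omega>. ln (Z \<omega>)) \<le> a + 1" using mean_scaled_le(2) by simp
qed

lemma ln_square_mean:
  "integrable M (\<lambda>\<omega>. (ln (Z \<omega>))\<^sup>2)" "expectation (\<lambda>\<omega>. (ln (Z \<omega>))\<^sup>2) \<le> 2 * a\<^sup>2 + 4"
proof -
  have [measurable]: "Z \<in> borel_measurable M" using Zint by simp
  have le: "(ln (Z \<omega>))\<^sup>2 \<le> 2 * a\<^sup>2 + 4 * (Z \<omega> * exp (- a))" for \<omega>
  proof (cases "ln (Z \<omega>) \<le> a")
    case True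
    then have "(ln (Z \<omega>))\<^sup>2 \<le> a\<^sup>2" using Z1[of \<omega>] by (intro power_mono) auto
    moreover have "0 \<le> Z \<omega> * exp (- a)" using Z1[of \<omega>] by simp
    moreover have "0 \<le> a\<^sup>2" by simp
    ultimately show ?thesis by linarith
  next
    case False
    define d where "d = ln (Z \<omega>) - a"
    have "1 + d + d\<^sup>2 / 2 \<le> exp d" using False by (intro exp_lower_Taylor_quadratic) (simp add: d_def)
    then have "2 * d\<^sup>2 \<le> 4 * exp d" using False by (simp add: d_def)
    moreover have "exp d = Z \<omega> * exp (- a)" using Z1[of \<omega>] by (simp add: d_def exp_diff exp_minus field_simps)
    moreover have "(ln (Z \<omega>))\<^sup>2 \<le> 2 * a\<^sup>2 + 2 * d\<^sup>2"
    proof -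
      have "(ln (Z \<omega>))\<^sup>2 + (a - d)\<^sup>2 = 2 * a\<^sup>2 + 2 * d\<^sup>2"
        by (simp add: d_def power2_eq_square algebra_simps)
      then show ?thesis using zero_le_power2[of "a - d"] by (metis le_add_same_cancel1)
    qed
    ultimately show ?thesis by simp
  qed
  have bi: "integrable M (\<lambda>\<omega>. 2 * a\<^sup>2 + 4 * (Z \<omega> * exp (- a)))" using mean_scaled_le(1) by simp
  show i: "integrable M (\<lambda>\<omega>. (ln (Z \<omega>))\<^sup>2)"
  proof (rule Bochner_Integration.integrable_bound[OF bi])
    have "norm ((ln (Z \<omega>))\<^sup>2) \<le> norm (2 * a\<^sup>2 + 4 * (Z \<omega> * exp (- a)))" for \<omega>
      using le[of \<omega>] by (simp add: order.trans[OF _ abs_ge_self])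
    then show "AE \<omega> in M. norm ((ln (Z \<omega>))\<^sup>2) \<le> norm (2 * a\<^sup>2 + 4 * (Z \<omega> * exp (- a)))" by simp
  qed simp
  have "expectation (\<lambda>\<omega>. (ln (Z \<omega>))\<^sup>2) \<le> expectation (\<lambda>\<omega>. 2 * a\<^sup>2 + 4 * (Z \<omega> * exp (- a)))"
    by (intro integral_mono i bi le)
  also have "\<dots> = 2 * a\<^sup>2 + 4 * expectation (\<lambda>\<omega>. Z \<omega> * exp (- a))"
    using mean_scaled_le(1) by (simp add: prob_space)
  finally show "expectation (\<lambda>\<omega>. (ln (Z \<omega>))\<^sup>2) \<le> 2 * a\<^sup>2 + 4" using mean_scaled_le(2) by simp
qed

lemma ln_tail: "prob {\<omega>\<in>space M. t \<le> ln (Z \<omega>)} \<le> exp (a - t)"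
proof -
  have [measurable]: "Z \<in> borel_measurable M" using Zint by simp
  have "0 < Z \<omega>" for \<omega> using Z1[of \<omega>] by linarith
  then have "{\<omega>\<in>space M. t \<le> ln (Z \<omega>)} = {\<omega>\<in>space M. Z \<omega> \<ge> exp t}" by (simp add: ln_ge_iff)
  then have "prob {\<omega>\<in>space M. t \<le> ln (Z \<omega>)} \<le> expectation Z / exp t"
    using integral_Markov_inequality_measure[OF Zint, of "{}" "exp t"] Z1
    by (simp add: order.trans[OF zero_le_one])
  also have "\<dots> \<le> exp a / exp t" using Za by (intro divide_right_mono) auto
  finally show ?thesis by (simp add: exp_diff)
qed

end

end

section \<open>From the noise to the law of the data\<close>

lemma prob_space_noise: "prob_space (noise p n)"
  unfolding noise_def by (intro prob_space_PiM prob_space_std_normal)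

lemma observation_carrier [simp]: "observation p n \<sigma> \<theta> \<eta> \<omega> \<in> carrier_mat p n"
  by (simp add: observation_def)

lemma observation_measurable [measurable]:
  "observation p n \<sigma> \<theta> \<eta> \<in> measurable (noise p n) (borel_mat p n)"
  unfolding borel_mat_def
proof (rule measurable_vimage_algebra2)
  have "(\<lambda>\<omega>. observation p n \<sigma> \<theta> \<eta> \<omega> $$ ki) \<in> borel_measurable (noise p n)" if "ki \<in> mat_indices p n" for ki
  proof -
    have [measurable]: "(\<lambda>\<omega>. \<omega> ki) \<in> borel_measurable (noise p n)"
      using measurable_component_singleton[OF that, of "\<lambda>_. std_normal_distribution"] by (simp add: noise_def)
    have "observation p n \<sigma> \<theta> \<eta> \<omega> $$ ki = \<theta> $ fst ki * \<eta> $ snd ki + \<sigma> * \<omega> ki" for \<omega>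
      using that by (cases ki) (auto simp: observation_def mat_indices_def)
    then show ?thesis by simp
  qed
  then show "(\<lambda>\<omega>. \<lambda>ki\<in>mat_indices p n. observation p n \<sigma> \<theta> \<eta> \<omega> $$ ki)
      \<in> measurable (noise p n) (\<Pi>\<^sub>M ki\<in>mat_indices p n. borel)"
    by (rule measurable_restrict)
qed auto

text \<open>By convention a function that is not integrable has integral 0 and a set that is not measurable has
  measure 0; both values lie below the nonnegative bounds of this lemma and the next.\<close>

lemma law_integral_le:
  fixes f :: "real mat \<Rightarrow> real" and g :: "(nat \<times> nat \<Rightarrow> real) \<Rightarrow> real"
  assumes g: "integrable (noise p n) g" "\<And>\<omega>. 0 \<le> g \<omega>"
    and fg: "\<And>\<omega>. f (observation p n \<sigma> \<theta> \<eta> \<omega>) \<le> g \<omega>"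
  shows "(LINT Y | law p n \<sigma> \<theta> \<eta>. f Y) \<le> (LINT \<omega> | noise p n. g \<omega>)"
proof (cases "integrable (law p n \<sigma> \<theta> \<eta>) f")
  case True
  then have "f \<in> borel_measurable (borel_mat p n)" unfolding law_def by (auto dest: borel_measurable_integrable)
  then have "(LINT Y | law p n \<sigma> \<theta> \<eta>. f Y) = (LINT \<omega> | noise p n. f (observation p n \<sigma> \<theta> \<eta> \<omega>))"
    unfolding law_def by (rule integral_distr[OF observation_measurable])
  also have "\<dots> \<le> (LINT \<omega> | noise p n. g \<omega>)" using g fg by (intro integral_mono') auto
  finally show ?thesis .
next
  case False
  then show ?thesis using g(2) by (simp add: not_integrable_integral_eq)
qed

lemma law_prob_le:
  assumes B: "B \<in> sets (noise p n)"
    and sub: "\<And>\<omega>. \<omega> \<in> space (noise p n) \<Longrightarrow> P (observation p n \<sigma> \<theta> \<eta> \<omega>) \<Longrightarrow> \<omega> \<in> B"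
  shows "\<P>(Y in law p n \<sigma> \<theta> \<eta>. P Y) \<le> measure (noise p n) B"
proof (cases "{Y \<in> space (law p n \<sigma> \<theta> \<eta>). P Y} \<in> sets (law p n \<sigma> \<theta> \<eta>)")
  case True
  interpret prob_space "noise p n" by (rule prob_space_noise)
  have "\<P>(Y in law p n \<sigma> \<theta> \<eta>. P Y)
      = prob (observation p n \<sigma> \<theta> \<eta> -` {Y \<in> space (law p n \<sigma> \<theta> \<eta>). P Y} \<inter> space (noise p n))"
    using True unfolding law_def by (intro measure_distr observation_measurable) simp
  also have "\<dots> \<le> prob B" using sub by (intro finite_measure_mono B) auto
  finally show ?thesis .
qed (simp add: measure_notin_sets)

section \<open>Risk and tail of the spectral sign estimator\<close>

text \<open>The bound of \<open>spectral_errors_pathwise\<close> with \<open>2 ln Z / lam\<close> as the bound for \<open>W\<^sup>T W - p I\<close>, in the scale-free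
  quantities \<open>x = \<tau> / \<sigma>\<^sup>2\<close> and \<open>\<parallel>W\<^sup>T \<theta>\<parallel>\<^sup>2 / \<tau>\<close>; it depends on the data through the noise only.\<close>

definition error_bound :: "nat \<Rightarrow> nat \<Rightarrow> real \<Rightarrow> real \<Rightarrow> real vec \<Rightarrow> real \<Rightarrow> (nat \<times> nat \<Rightarrow> real) \<Rightarrow> real" where
  "error_bound p n x \<tau> \<theta> lam \<omega> = (512 * real n * x * (sqnorm n (noise_projection p \<theta> \<omega>) / \<tau>)
     + 512 * (ln (net_partition p n lam \<omega>))\<^sup>2 / lam\<^sup>2) / ((real n)\<^sup>2 * x\<^sup>2)"

lemma estimator_error_bound:
  assumes n: "n > 0" and \<sigma>: "\<sigma> > 0" and \<theta>: "\<theta> \<in> carrier_vec p" and \<tau>: "\<tau> = (\<Sum>k<p. (\<theta> $ k)\<^sup>2)" "\<tau> > 0"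
    and x: "x = \<tau> / \<sigma>\<^sup>2" and \<eta>: "\<eta> \<in> sign_vecs n" and s0: "s0 \<in> {-1, 1}" and lam: "lam > 0"
    and sel: "spectral_selection p n v"
  shows "1 / real n * loss n (sign_vec s0 (v (observation p n \<sigma> \<theta> \<eta> \<omega>))) \<eta> \<le> error_bound p n x \<tau> \<theta> lam \<omega>"
    and "1 - error_bound p n x \<tau> \<theta> lam \<omega> \<le> 1 / real n * \<bar>\<eta> \<bullet> sign_vec s0 (v (observation p n \<sigma> \<theta> \<eta> \<omega>))\<bar>"
proof -
  let ?Y = "observation p n \<sigma> \<theta> \<eta> \<omega>"
  define S where "S = 2 * ln (net_partition p n lam \<omega>) / lam"
  define G where "G = sqnorm n (noise_projection p \<theta> \<omega>)"
  define D where "D = 16 * (4 * \<sigma> * sqrt (real n * G) + 2 * \<sigma>\<^sup>2 * S)\<^sup>2 / (real n * \<tau>)\<^sup>2"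
  have S: "S > 0" "form_bounded n (noise_gram p \<omega>) S"
    using net_partition_bounds[OF n lam, of p \<omega>] lam by (simp_all add: S_def)
  have top: "top_eigenvector (hollow (transpose_mat ?Y * ?Y)) (v ?Y)"
    using sel by (simp add: spectral_selection_def)
  note path = spectral_errors_pathwise[OF n \<sigma> \<theta> \<tau> \<eta> s0 S refl top D_def[unfolded G_def]]
  have sq: "(u + w)\<^sup>2 \<le> 2 * u\<^sup>2 + 2 * w\<^sup>2" for u w :: real
  proof -
    have "(u + w)\<^sup>2 + (u - w)\<^sup>2 = 2 * u\<^sup>2 + 2 * w\<^sup>2" by (simp add: power2_eq_square algebra_simps)
    then show ?thesis using zero_le_power2[of "u - w"] by (metis le_add_same_cancel1)
  qed
  have G0: "G \<ge> 0" by (simp add: G_def)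
  have "D \<le> 16 * (2 * (4 * \<sigma> * sqrt (real n * G))\<^sup>2 + 2 * (2 * \<sigma>\<^sup>2 * S)\<^sup>2) / (real n * \<tau>)\<^sup>2"
    unfolding D_def by (intro divide_right_mono mult_left_mono sq) auto
  also have "\<dots> = (512 * real n * \<sigma>\<^sup>2 * G + 128 * (\<sigma>\<^sup>2)\<^sup>2 * S\<^sup>2) / (real n * \<tau>)\<^sup>2"
    using G0 by (simp add: power_mult_distrib)
  also have "\<dots> = error_bound p n x \<tau> \<theta> lam \<omega>"
  proof -
    have \<tau>x: "\<tau> = x * \<sigma>\<^sup>2" and x0: "x > 0" using \<sigma> \<tau>(2) by (simp_all add: x)
    have "S\<^sup>2 = 4 * (ln (net_partition p n lam \<omega>))\<^sup>2 / lam\<^sup>2"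
      by (simp add: S_def power_divide power_mult_distrib)
    then have eb: "error_bound p n x \<tau> \<theta> lam \<omega> = (512 * real n * x * (G / \<tau>) + 128 * S\<^sup>2) / ((real n)\<^sup>2 * x\<^sup>2)"
      by (simp add: error_bound_def G_def)
    define q where "q = \<sigma>\<^sup>2"
    have q: "q > 0" using \<sigma> by (simp add: q_def)
    show ?thesis unfolding eb unfolding \<tau>x q_def[symmetric] power_mult_distrib
      using q x0 n by (simp add: divide_simps) (simp add: power2_eq_square algebra_simps)
  qed
  finally have D: "D \<le> error_bound p n x \<tau> \<theta> lam \<omega>" .
  show "1 / real n * loss n (sign_vec s0 (v ?Y)) \<eta> \<le> error_bound p n x \<tau> \<theta> lam \<omega>"
    using path(1) D by linarith
  show "1 - error_bound p n x \<tau> \<theta> lam \<omega> \<le> 1 / real n * \<bar>\<eta> \<bullet> sign_vec s0 (v ?Y)\<bar>"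
    using path(2) D by linarith
qed

text \<open>The variable is chi-square with \<open>n\<close> degrees of freedom, and a quarter of it is the logarithm of
  the exponential bounded in \<open>projection_mgf\<close>.\<close>

lemma projection_mean:
  assumes \<tau>: "\<tau> = (\<Sum>k<p. (\<theta> $ k)\<^sup>2)" "\<tau> > 0"
  shows "integrable (noise p n) (\<lambda>\<omega>. sqnorm n (noise_projection p \<theta> \<omega>) / \<tau>)"
    and "(LINT \<omega> | noise p n. sqnorm n (noise_projection p \<theta> \<omega>) / \<tau>) \<le> 2 * real n + 4"
    and "measure (noise p n) {\<omega> \<in> space (noise p n). t \<le> sqnorm n (noise_projection p \<theta> \<omega>) / \<tau>} \<le> exp (real n / 2 - t / 4)"
proof -
  interpret prob_space "noise p n" by (rule prob_space_noise)
  let ?X = "\<lambda>\<omega>. sqnorm n (noise_projection p \<theta> \<omega>) / \<tau>"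
  have Z1: "1 \<le> exp (?X \<omega> / 4)" for \<omega> using \<tau>(2) by simp
  note * = ln_mean[OF Z1 projection_mgf[OF \<tau>]] ln_tail[OF Z1 projection_mgf[OF \<tau>], where t = "t / 4"]
  have i: "integrable (noise p n) (\<lambda>\<omega>. ?X \<omega> / 4)" using *(1) by simp
  have X: "?X \<omega> = 4 * (?X \<omega> / 4)" for \<omega> by simp
  show "integrable (noise p n) ?X" by (subst X) (rule integrable_mult_right[OF i])
  have "(LINT \<omega> | noise p n. ?X \<omega>) = 4 * (LINT \<omega> | noise p n. ?X \<omega> / 4)"
    by (subst X) (rule integral_mult_right_zero)
  also have "(LINT \<omega> | noise p n. ?X \<omega> / 4) \<le> real n / 2 + 1" using *(2) by (simp only: ln_exp)
  finally show "(LINT \<omega> | noise p n. ?X \<omega>) \<le> 2 * real n + 4" by simp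
  show "measure (noise p n) {\<omega> \<in> space (noise p n). t \<le> ?X \<omega>} \<le> exp (real n / 2 - t / 4)"
    using *(3) by (simp add: divide_le_cancel)
qed

text \<open>With the scale below, \<open>ln Z\<close> is of order \<open>n\<close> and \<open>1 / lam\<^sup>2\<close> of order \<open>1 + p / n\<close>. The two summands of the error bound
  thus have means of order \<open>1 / x\<close> and \<open>(1 + p / n) / x\<^sup>2\<close>.\<close>

lemma error_bound_mean:
  assumes n: "n \<ge> 2" and p: "p \<ge> 1" and x: "x > 0"
    and \<tau>: "\<tau> = (\<Sum>k<p. (\<theta> $ k)\<^sup>2)" "\<tau> > 0"
  shows "\<exists>lam>0. integrable (noise p n) (error_bound p n x \<tau> \<theta> lam) \<and>
    (LINT \<omega> | noise p n. error_bound p n x \<tau> \<theta> lam \<omega>) \<le> 2 ^ 24 * (x + 1 + real p / real n) / x\<^sup>2"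
proof -
  interpret prob_space "noise p n" by (rule prob_space_noise)
  have n0: "n > 0" using n by simp
  \<comment> \<open>As large as permitted while \<open>p * lam\<^sup>2\<close> stays at most \<open>n\<close>, the order of the logarithm of the net size.\<close>
  define lam where "lam = min (1/4) (sqrt (real n / real p))"
  have lam: "lam > 0" "\<bar>lam\<bar> \<le> 1/4" using n p by (auto simp: lam_def)
  have plam: "real p * lam\<^sup>2 \<le> real n"
  proof -
    have "lam\<^sup>2 \<le> (sqrt (real n / real p))\<^sup>2" using lam(1) by (intro power_mono) (auto simp: lam_def)
    then show ?thesis using p by (simp add: field_simps)
  qed
  have ilam: "1 / lam\<^sup>2 \<le> 16 + real p / real n"
  proof (cases "lam = 1/4")
    case True
    show ?thesis unfolding True by (simp add: power2_eq_square)
  next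
    case False
    then have "lam = sqrt (real n / real p)" by (auto simp: lam_def min_def split: if_splits)
    then have "lam\<^sup>2 = real n / real p" by simp
    then show ?thesis by simp
  qed
  define a where "a = 20 * real n + 4 * real p * lam\<^sup>2"
  have a0: "a \<ge> 0" by (simp add: a_def)
  have a: "a \<le> 24 * real n" using plam by (simp add: a_def)
  have Z1: "1 \<le> net_partition p n lam \<omega>" for \<omega> using net_partition_bounds(1)[OF n0 lam(1), of p \<omega>] by simp
  note lnZ = ln_square_mean[OF Z1 net_partition_mean[OF n0 lam(2), of p, folded a_def] a0]
  let ?X = "\<lambda>\<omega>. sqnorm n (noise_projection p \<theta> \<omega>) / \<tau>"
  note X = projection_mean[OF \<tau>, where n = n]
  let ?D = "(real n)\<^sup>2 * x\<^sup>2"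
  have int: "integrable (noise p n) (error_bound p n x \<tau> \<theta> lam)"
    unfolding error_bound_def[abs_def]
    by (intro integrable_divide Bochner_Integration.integrable_add integrable_mult_right X(1) lnZ(1))
  have "(LINT \<omega> | noise p n. error_bound p n x \<tau> \<theta> lam \<omega>)
      = (512 * real n * x * expectation ?X + 512 * expectation (\<lambda>\<omega>. (ln (net_partition p n lam \<omega>))\<^sup>2) / lam\<^sup>2) / ?D"
    unfolding error_bound_def integral_divide_zero
    by (subst Bochner_Integration.integral_add)
      (auto intro!: integrable_divide integrable_mult_right X(1) lnZ(1) simp only: integral_divide_zero integral_mult_right_zero)
  also have "\<dots> \<le> (512 * real n * x * (6 * real n) + 512 * (1153 * (real n)\<^sup>2) * (16 + real p / real n)) / ?D"
  proof (intro divide_right_mono add_mono)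
    have "expectation ?X \<le> 6 * real n" using X(2) n by simp
    then show "512 * real n * x * expectation ?X \<le> 512 * real n * x * (6 * real n)"
      using x by (intro mult_left_mono) auto
    have "a\<^sup>2 \<le> (24 * real n)\<^sup>2" using a a0 by (intro power_mono) auto
    moreover have "(2::real)\<^sup>2 \<le> (real n)\<^sup>2" using n by (intro power_mono) auto
    ultimately have "2 * a\<^sup>2 + 4 \<le> 1153 * (real n)\<^sup>2" by (simp add: power_mult_distrib)
    then have e: "expectation (\<lambda>\<omega>. (ln (net_partition p n lam \<omega>))\<^sup>2) \<le> 1153 * (real n)\<^sup>2" using lnZ(2) by linarith
    have "512 * expectation (\<lambda>\<omega>. (ln (net_partition p n lam \<omega>))\<^sup>2) * (1 / lam\<^sup>2)
        \<le> 512 * (1153 * (real n)\<^sup>2) * (16 + real p / real n)"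
      using e ilam by (intro mult_mono) auto
    then show "512 * expectation (\<lambda>\<omega>. (ln (net_partition p n lam \<omega>))\<^sup>2) / lam\<^sup>2
        \<le> 512 * (1153 * (real n)\<^sup>2) * (16 + real p / real n)" by simp
  qed auto
  also have "\<dots> = (3072 * x + 590336 * (16 + real p / real n)) / x\<^sup>2"
    using n0 x by (simp add: field_simps power2_eq_square)
  also have "\<dots> \<le> 2 ^ 24 * (x + 1 + real p / real n) / x\<^sup>2"
  proof (intro divide_right_mono)
    have le: "3072 * x + 590336 * (16 + q) \<le> 2 ^ 24 * (x + 1 + q)" if "0 \<le> q" for q using x that by simp
    show "3072 * x + 590336 * (16 + real p / real n) \<le> 2 ^ 24 * (x + 1 + real p / real n)"
      by (rule le) simp
  qed simp
  finally show ?thesis using lam(1) int by blast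
qed

text \<open>With \<open>L = r\<^sup>2 ln n + 2\<^sup>2\<^sup>8 n\<close> the threshold equals \<open>L / (n r\<^sup>2)\<close>. If the error bound exceeds it, one of its two summands
  is at least half as large. By \<open>r\<^sup>2 \<le> x\<close>, the first one then forces the chi-square variable above \<open>L / 1024\<close>; by
  \<open>x + p / n \<le> x\<^sup>2 / r\<^sup>2\<close>, the second one forces \<open>ln Z\<close> above \<open>2 \<kappa> L\<close> with \<open>\<kappa> = 2\<^sup>-\<^sup>2\<^sup>3\<close>. The mean of \<open>Z\<close> contributes
  \<open>20 n + 4 p lam\<^sup>2\<close> to the exponent, where the quadratic part takes at most \<open>\<kappa> L\<close>; the \<open>2\<^sup>2\<^sup>8 \<kappa> n = 32 n\<close> in the remaining
  \<open>\<kappa> L\<close> absorb \<open>20 n\<close>. The same \<open>\<kappa>\<close> keeps the scale below \<open>1/4\<close>.\<close>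

lemma error_bound_tail:
  assumes n: "n \<ge> 2" and p: "p \<ge> 1" and r: "r \<ge> 1" and rx: "r\<^sup>2 * (x + real p / real n) \<le> x\<^sup>2" and x: "x > 0"
    and \<tau>: "\<tau> = (\<Sum>k<p. (\<theta> $ k)\<^sup>2)" "\<tau> > 0"
  shows "\<exists>lam>0. \<exists>B \<in> sets (noise p n).
    (\<forall>\<omega>\<in>space (noise p n). ln (real n) / real n + 2 ^ 28 / r\<^sup>2 \<le> error_bound p n x \<tau> \<theta> lam \<omega> \<longrightarrow> \<omega> \<in> B) \<and>
    measure (noise p n) B \<le> 2 * exp (- real n - r\<^sup>2 * ln (real n) / 2 ^ 23)"
proof -
  interpret prob_space "noise p n" by (rule prob_space_noise)
  have n0: "n > 0" using n by simp
  have r2: "r\<^sup>2 \<ge> 1" using r by simp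
  have rx1: "r\<^sup>2 \<le> x"
  proof -
    have "r\<^sup>2 * x \<le> r\<^sup>2 * (x + real p / real n)" by (intro mult_left_mono) auto
    then have "r\<^sup>2 * x \<le> x * x" using rx by (simp add: power2_eq_square[of x])
    then show ?thesis using x by simp
  qed
  define l where "l = ln (real n)"
  have l: "0 \<le> l" "l \<le> real n" using n ln_bound[of "real n"] by (auto simp: l_def)
  define L where "L = r\<^sup>2 * l + 2 ^ 28 * real n"
  define \<kappa> :: real where "\<kappa> = 1 / 2 ^ 23"
  have L0: "L > 0" using n l by (simp add: L_def add_nonneg_pos)
  define N where "N = real n * x + real p"
  have N0: "N > 0" using n0 x by (simp add: N_def add_pos_nonneg)
  \<comment> \<open>The scale is tied to \<open>L\<close> so that the threshold for \<open>ln Z\<close> below is proportional to \<open>L\<close>.\<close>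
  define lam where "lam = sqrt (4096 * \<kappa>\<^sup>2 * L / N)"
  have lam2: "lam\<^sup>2 = 4096 * \<kappa>\<^sup>2 * L / N" using L0 N0 by (simp add: lam_def \<kappa>_def)
  have lam0: "lam > 0" using L0 N0 by (simp add: lam_def \<kappa>_def)
  have LN: "L \<le> 2 ^ 29 * N"
  proof -
    have "r\<^sup>2 * l \<le> x * real n" using rx1 l x by (intro mult_mono) auto
    moreover have "real n \<le> real n * x" using rx1 r2 n0 by simp
    ultimately show ?thesis by (simp add: L_def N_def mult.commute)
  qed
  have "lam\<^sup>2 \<le> (1/4)\<^sup>2"
    using LN N0 by (simp add: lam2 \<kappa>_def field_simps)
  then have lam4: "\<bar>lam\<bar> \<le> 1/4" using lam0 by (simp add: abs_le_square_iff)
  have plam: "real p * lam\<^sup>2 \<le> 4096 * \<kappa>\<^sup>2 * L"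
  proof -
    have "real p / N \<le> 1" using n0 x N0 by (simp add: N_def)
    then have "(4096 * \<kappa>\<^sup>2 * L) * (real p / N) \<le> (4096 * \<kappa>\<^sup>2 * L) * 1" using L0 by (intro mult_left_mono) auto
    then show ?thesis by (simp add: lam2 mult_ac)
  qed
  define a where "a = 20 * real n + 4 * real p * lam\<^sup>2"
  have a0: "a \<ge> 0" by (simp add: a_def)
  have Z1: "1 \<le> net_partition p n lam \<omega>" for \<omega> using net_partition_bounds(1)[OF n0 lam0, of p \<omega>] by simp
  note Zm = net_partition_mean[OF n0 lam4, of p, folded a_def]
  note tail = ln_tail[OF Z1 Zm a0, of "2 * \<kappa> * L"]
  let ?X = "\<lambda>\<omega>. sqnorm n (noise_projection p \<theta> \<omega>) / \<tau>"
  let ?Z = "\<lambda>\<omega>. ln (net_partition p n lam \<omega>)"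
  have [measurable]: "?X \<in> borel_measurable (noise p n)" "net_partition p n lam \<in> borel_measurable (noise p n)"
    using projection_mean(1)[OF \<tau>] Zm(1) by (auto dest: borel_measurable_integrable)
  define B1 where "B1 = {\<omega> \<in> space (noise p n). L / 1024 \<le> ?X \<omega>}"
  define B2 where "B2 = {\<omega> \<in> space (noise p n). 2 * \<kappa> * L \<le> ?Z \<omega>}"
  have sets: "B1 \<in> events" "B2 \<in> events" unfolding B1_def B2_def by measurable
  have "\<omega> \<in> B1 \<union> B2"
    if \<omega>: "\<omega> \<in> space (noise p n)" "l / real n + 2 ^ 28 / r\<^sup>2 \<le> error_bound p n x \<tau> \<theta> lam \<omega>" for \<omega>
  proof -
    define V where "V = real n * L * (x\<^sup>2 / r\<^sup>2)"
    have "V = (l / real n + 2 ^ 28 / r\<^sup>2) * ((real n)\<^sup>2 * x\<^sup>2)"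
      using n0 r by (simp add: V_def L_def field_simps power2_eq_square)
    also have "\<dots> \<le> error_bound p n x \<tau> \<theta> lam \<omega> * ((real n)\<^sup>2 * x\<^sup>2)"
      using \<omega>(2) by (intro mult_right_mono) auto
    also have "\<dots> = 512 * real n * x * ?X \<omega> + 512 * (?Z \<omega>)\<^sup>2 / lam\<^sup>2"
      using n0 x by (simp add: error_bound_def)
    finally have "V \<le> 2 * (512 * real n * x * ?X \<omega>) \<or> V \<le> 2 * (512 * (?Z \<omega>)\<^sup>2 / lam\<^sup>2)" by linarith
    then show ?thesis
    proof
      assume *: "V \<le> 2 * (512 * real n * x * ?X \<omega>)"
      have "1 \<le> x / r\<^sup>2" using rx1 r2 by (subst le_divide_eq_1_pos) auto
      then have "1 * x \<le> (x / r\<^sup>2) * x" using x by (intro mult_right_mono) auto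
      then have "real n * L * x \<le> V"
        unfolding V_def using n0 L0 by (intro mult_left_mono) (auto simp: power2_eq_square)
      then have "(real n * x) * L \<le> (real n * x) * (1024 * ?X \<omega>)" using * by (simp add: mult_ac)
      moreover have "real n * x > 0" using n0 x by simp
      ultimately have "L \<le> 1024 * ?X \<omega>" by (rule mult_left_le_imp_le)
      then have "L / 1024 \<le> ?X \<omega>" by linarith
      then show ?thesis using \<omega>(1) by (simp only: B1_def mem_Collect_eq Un_iff simp_thms)
    next
      assume *: "V \<le> 2 * (512 * (?Z \<omega>)\<^sup>2 / lam\<^sup>2)"
      have "(x + real p / real n) * r\<^sup>2 \<le> x\<^sup>2" using rx by (simp only: mult.commute)
      then have "x + real p / real n \<le> x\<^sup>2 / r\<^sup>2" using r2 by (subst pos_le_divide_eq) auto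
      then have "real n * L * (x + real p / real n) \<le> V"
        unfolding V_def using n0 L0 by (intro mult_left_mono) auto
      moreover have "real n * L * (x + real p / real n) = L * N" using n0 by (simp add: N_def field_simps)
      ultimately have "L * N * lam\<^sup>2 \<le> V * lam\<^sup>2" by (intro mult_right_mono) auto
      also have "\<dots> \<le> 2 * (512 * (?Z \<omega>)\<^sup>2 / lam\<^sup>2) * lam\<^sup>2" using * by (intro mult_right_mono) auto
      also have "\<dots> = 1024 * (?Z \<omega>)\<^sup>2" using lam0 by simp
      finally have "L * N * lam\<^sup>2 \<le> 1024 * (?Z \<omega>)\<^sup>2" .
      moreover have "L * N * lam\<^sup>2 = 1024 * (2 * \<kappa> * L)\<^sup>2" using N0 unfolding lam2 by (simp add: power2_eq_square)
      ultimately have "(2 * \<kappa> * L)\<^sup>2 \<le> (?Z \<omega>)\<^sup>2" by simp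
      moreover have "0 \<le> ?Z \<omega>" using Z1[of \<omega>] by simp
      ultimately have "2 * \<kappa> * L \<le> ?Z \<omega>" by (rule power2_le_imp_le)
      then show ?thesis using \<omega>(1) by (simp add: B2_def)
    qed
  qed
  moreover have "prob (B1 \<union> B2) \<le> 2 * exp (- real n - r\<^sup>2 * l / 2 ^ 23)"
  proof -
    have rl: "r\<^sup>2 * l \<ge> 0" using l by simp
    have "prob B1 \<le> exp (real n / 2 - L / 1024 / 4)" unfolding B1_def by (rule projection_mean(3)[OF \<tau>])
    also have "\<dots> \<le> exp (- real n - r\<^sup>2 * l / 2 ^ 23)"
    proof -
      have "m / 2 - (y + 2 ^ 28 * m) / 1024 / 4 \<le> - m - y / 2 ^ 23" if "0 \<le> y" "0 \<le> m" for y m :: real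
        using that by (simp add: field_simps)
      from this[OF rl of_nat_0_le_iff] show ?thesis unfolding L_def exp_le_cancel_iff .
    qed
    finally have 1: "prob B1 \<le> exp (- real n - r\<^sup>2 * l / 2 ^ 23)" .
    have "prob B2 \<le> exp (a - 2 * \<kappa> * L)" unfolding B2_def by (rule tail)
    also have "\<dots> \<le> exp (- real n - r\<^sup>2 * l / 2 ^ 23)"
    proof -
      have "4 * (real p * lam\<^sup>2) \<le> \<kappa> * L"
      proof -
        have "4 * (real p * lam\<^sup>2) \<le> (16384 * \<kappa>) * (\<kappa> * L)" using plam by (simp add: power2_eq_square mult_ac)
        also have "\<dots> \<le> 1 * (\<kappa> * L)" using L0 by (intro mult_right_mono) (auto simp: \<kappa>_def)
        finally show ?thesis by simp
      qed
      moreover have "\<kappa> * L = r\<^sup>2 * l / 2 ^ 23 + 32 * real n" by (simp add: \<kappa>_def L_def)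
      ultimately show ?thesis by (simp add: a_def)
    qed
    finally have "prob B2 \<le> exp (- real n - r\<^sup>2 * l / 2 ^ 23)" .
    with 1 measure_Un_le[OF sets] show ?thesis by simp
  qed
  ultimately show ?thesis using sets lam0 unfolding l_def by blast
qed

text \<open>On \<open>(t, t + 1]\<close> the density is at least its value at \<open>t + 1\<close>, and \<open>(t + 1)\<^sup>2 \<le> 2 t\<^sup>2 + 2\<close>. The constant in the
  exponent is not sharp; the logarithmic factor in \<open>overlap_tail\<close> makes up for it.\<close>

lemma gauss_tail_lower:
  assumes "t \<ge> 0"
  shows "exp (- t\<^sup>2 - 1) / sqrt (2 * pi) \<le> gauss_tail t"
proof -
  interpret prob_space std_normal_distribution by (rule prob_space_std_normal)
  let ?c = "exp (- t\<^sup>2 - 1) / sqrt (2 * pi)"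
  have dens: "?c \<le> std_normal_density y" if "y \<in> {t<..t + 1}" for y
  proof -
    have "y\<^sup>2 \<le> (t + 1)\<^sup>2" using that assms by (intro power_mono) auto
    also have "\<dots> \<le> 2 * t\<^sup>2 + 2"
      using zero_le_power2[of "t - 1"] by (simp add: power2_eq_square algebra_simps)
    finally have "- t\<^sup>2 - 1 \<le> - y\<^sup>2 / 2" by simp
    then show ?thesis unfolding std_normal_density_def by (simp add: divide_right_mono)
  qed
  have "ennreal ?c = (\<integral>\<^sup>+ y. ennreal ?c * indicator {t<..t + 1} y \<partial>lborel)"
    by (subst nn_integral_cmult_indicator) simp_all
  also have "\<dots> \<le> (\<integral>\<^sup>+ y. ennreal (std_normal_density y) * indicator {t<..} y \<partial>lborel)"
    using dens by (intro nn_integral_mono) (auto simp: indicator_def intro!: ennreal_leI)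
  also have "\<dots> = emeasure std_normal_distribution {t<..}"
    by (subst emeasure_density) simp_all
  also have "\<dots> = ennreal (gauss_tail t)" by (simp add: gauss_tail_def emeasure_eq_measure)
  finally show ?thesis by (simp add: gauss_tail_def)
qed

text \<open>The map \<open>d \<mapsto> d\<^sup>2 / (d + q)\<close> is increasing, so a signal stronger than \<open>\<Delta>\<close> has at least the ratio of \<open>\<Delta>\<close>.\<close>

lemma r_ratio_le:
  assumes \<sigma>: "\<sigma> > 0" and \<Delta>: "\<Delta> > 0" and x: "\<Delta>\<^sup>2 / \<sigma>\<^sup>2 \<le> x"
  shows "(r_ratio p n \<sigma> \<Delta>)\<^sup>2 * (x + real p / real n) \<le> x\<^sup>2"
proof -
  define d where "d = \<Delta>\<^sup>2 / \<sigma>\<^sup>2"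
  define q where "q = real p / real n"
  have d: "d > 0" and q: "q \<ge> 0" and dx: "d \<le> x" using \<sigma> \<Delta> x by (auto simp: d_def q_def)
  have r: "(r_ratio p n \<sigma> \<Delta>)\<^sup>2 = d\<^sup>2 / (d + q)"
    using d q by (simp add: r_ratio_def d_def[symmetric] q_def[symmetric] power_divide)
  have "d\<^sup>2 * x \<le> x\<^sup>2 * d"
    using d dx by (simp add: power2_eq_square mult_ac mult_left_mono)
  moreover have "d\<^sup>2 * q \<le> x\<^sup>2 * q" using d dx q by (intro mult_right_mono power_mono) auto
  ultimately have "d\<^sup>2 * (x + q) \<le> x\<^sup>2 * (d + q)" by (simp add: algebra_simps)
  then show ?thesis using d q by (simp add: r q_def[symmetric] pos_divide_le_eq add_pos_nonneg)
qed

lemma Omega_signal: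
  assumes "(\<theta>, \<eta>) \<in> Omega p n \<Delta>" "\<sigma> > 0" "\<Delta> > 0"
  shows "\<theta> \<in> carrier_vec p" "\<eta> \<in> sign_vecs n" "(\<Sum>k<p. (\<theta> $ k)\<^sup>2) > 0"
    "\<Delta>\<^sup>2 / \<sigma>\<^sup>2 \<le> (\<Sum>k<p. (\<theta> $ k)\<^sup>2) / \<sigma>\<^sup>2"
proof -
  show \<theta>: "\<theta> \<in> carrier_vec p" and "\<eta> \<in> sign_vecs n" using assms(1) by (auto simp: Omega_def)
  have "\<theta> \<bullet> \<theta> = (\<Sum>k<p. (\<theta> $ k)\<^sup>2)"
    using \<theta> by (auto simp: scalar_prod_def power2_eq_square atLeast0LessThan)
  then have "\<Delta> \<le> sqrt (\<Sum>k<p. (\<theta> $ k)\<^sup>2)" using assms(1) by (simp add: Omega_def vec_norm_def)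
  then have le: "\<Delta>\<^sup>2 \<le> (\<Sum>k<p. (\<theta> $ k)\<^sup>2)"
    using assms(3) by (metis less_eq_real_def power_mono real_sqrt_pow2 sum_nonneg zero_le_power2)
  then show "\<Delta>\<^sup>2 / \<sigma>\<^sup>2 \<le> (\<Sum>k<p. (\<theta> $ k)\<^sup>2) / \<sigma>\<^sup>2" by (intro divide_right_mono) auto
  show "(\<Sum>k<p. (\<theta> $ k)\<^sup>2) > 0" using le assms(3) by (meson less_le_trans zero_less_power)
qed

lemma Omega_nonempty:
  assumes "p \<ge> 1" "\<Delta> > 0"
  shows "Omega p n \<Delta> \<noteq> {}"
proof -
  let ?\<theta> = "vec p (\<lambda>k. if k = 0 then \<Delta> else 0)"
  have "?\<theta> \<bullet> ?\<theta> = (\<Sum>k<p. (if k = 0 then \<Delta> else 0) * (if k = 0 then \<Delta> else 0))"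
    by (simp add: scalar_prod_def atLeast0LessThan)
  also have "\<dots> = (\<Sum>k<p. if k = 0 then \<Delta>\<^sup>2 else 0)"
    by (intro sum.cong refl) (simp add: power2_eq_square)
  finally have "vec_norm ?\<theta> = \<Delta>" using assms by (simp add: vec_norm_def)
  then have "(?\<theta>, vec n (\<lambda>_. 1)) \<in> Omega p n \<Delta>" by (simp add: Omega_def sign_vecs_def)
  then show ?thesis by blast
qed

lemma signal_ge_one:
  assumes "r \<ge> 1" "r\<^sup>2 * (x + q) \<le> x\<^sup>2" "x > 0" "q \<ge> 0"
  shows "(1::real) \<le> x"
proof -
  have "1 * x \<le> r\<^sup>2 * (x + q)" using assms by (intro mult_mono) auto
  then have "1 * x \<le> x * x" using assms(2) by (simp add: power2_eq_square[of x])
  then show ?thesis using assms(3) by simp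
qed

lemma risk_bound:
  assumes n: "n \<ge> 2" and p: "p \<ge> 1" and \<sigma>: "\<sigma> > 0" and \<Delta>: "\<Delta> > 0" and r: "r_ratio p n \<sigma> \<Delta> \<ge> 1"
    and sel: "spectral_selection p n v" and s0: "s0 \<in> {-1, 1}" and \<Omega>: "(\<theta>, \<eta>) \<in> Omega p n \<Delta>"
  shows "1 / real n * (LINT Y | law p n \<sigma> \<theta> \<eta>. loss n (sign_vec s0 (v Y)) \<eta>) \<le> 2 ^ 28 / (r_ratio p n \<sigma> \<Delta>)\<^sup>2"
proof -
  let ?r = "r_ratio p n \<sigma> \<Delta>"
  define \<tau> where "\<tau> = (\<Sum>k<p. (\<theta> $ k)\<^sup>2)"
  define x where "x = \<tau> / \<sigma>\<^sup>2"
  note sig = Omega_signal[OF \<Omega> \<sigma> \<Delta>, folded \<tau>_def, folded x_def]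
  have x: "x > 0" using sig(3) \<sigma> by (simp add: x_def)
  have rx: "?r\<^sup>2 * (x + real p / real n) \<le> x\<^sup>2" by (rule r_ratio_le[OF \<sigma> \<Delta> sig(4)])
  have x1: "1 \<le> x" by (rule signal_ge_one[OF r rx x]) simp
  obtain lam where lam: "lam > 0" and int: "integrable (noise p n) (error_bound p n x \<tau> \<theta> lam)"
    and mean: "(LINT \<omega> | noise p n. error_bound p n x \<tau> \<theta> lam \<omega>) \<le> 2 ^ 24 * (x + 1 + real p / real n) / x\<^sup>2"
    using error_bound_mean[OF n p x \<tau>_def sig(3)] by blast
  have n0: "n > 0" using n by simp
  note err = estimator_error_bound[OF n0 \<sigma> sig(1) \<tau>_def sig(3) x_def sig(2) s0 lam sel]
  have "1 / real n * (LINT Y | law p n \<sigma> \<theta> \<eta>. loss n (sign_vec s0 (v Y)) \<eta>)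
      = (LINT Y | law p n \<sigma> \<theta> \<eta>. 1 / real n * loss n (sign_vec s0 (v Y)) \<eta>)"
    by (rule integral_mult_right_zero[symmetric])
  also have "\<dots> \<le> (LINT \<omega> | noise p n. error_bound p n x \<tau> \<theta> lam \<omega>)"
  proof (rule law_integral_le[OF int])
    show "0 \<le> error_bound p n x \<tau> \<theta> lam \<omega>" for \<omega>
      unfolding error_bound_def using x sig(3) by (intro divide_nonneg_nonneg add_nonneg_nonneg mult_nonneg_nonneg) auto
  qed (rule err(1))
  also have "\<dots> \<le> 2 ^ 24 * (x + 1 + real p / real n) / x\<^sup>2" by (rule mean)
  also have "\<dots> \<le> 2 ^ 28 * ((x + real p / real n) / x\<^sup>2)"
  proof -
    have "2 ^ 24 * (x + 1 + q) \<le> 2 ^ 28 * (x + q)" if "0 \<le> q" for q using x1 that by simp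
    from this[of "real p / real n"] show ?thesis
      by (simp only: times_divide_eq_right) (intro divide_right_mono, auto)
  qed
  also have "\<dots> \<le> 2 ^ 28 * (1 / ?r\<^sup>2)"
  proof (rule mult_left_mono)
    have "?r\<^sup>2 > 0" using r by simp
    then show "(x + real p / real n) / x\<^sup>2 \<le> 1 / ?r\<^sup>2"
      using rx x by (simp add: divide_simps mult.commute)
  qed simp
  finally show ?thesis by simp
qed

lemma overlap_tail:
  assumes n: "n \<ge> 2" and p: "p \<ge> 1" and \<sigma>: "\<sigma> > 0" and \<Delta>: "\<Delta> > 0" and r: "r_ratio p n \<sigma> \<Delta> \<ge> 1"
    and sel: "spectral_selection p n v" and s0: "s0 \<in> {-1, 1}" and \<Omega>: "(\<theta>, \<eta>) \<in> Omega p n \<Delta>"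
  shows "\<P>(Y in law p n \<sigma> \<theta> \<eta>. 1 / real n * \<bar>\<eta> \<bullet> sign_vec s0 (v Y)\<bar>
      \<le> 1 - ln (real n) / real n - 2 ^ 28 / (r_ratio p n \<sigma> \<Delta>)\<^sup>2)
    \<le> 2 * exp (- real n - (r_ratio p n \<sigma> \<Delta>)\<^sup>2 * ln (real n) / 2 ^ 23)"
proof -
  let ?r = "r_ratio p n \<sigma> \<Delta>"
  define \<tau> where "\<tau> = (\<Sum>k<p. (\<theta> $ k)\<^sup>2)"
  define x where "x = \<tau> / \<sigma>\<^sup>2"
  note sig = Omega_signal[OF \<Omega> \<sigma> \<Delta>, folded \<tau>_def, folded x_def]
  have x: "x > 0" using sig(3) \<sigma> by (simp add: x_def)
  have rx: "?r\<^sup>2 * (x + real p / real n) \<le> x\<^sup>2" by (rule r_ratio_le[OF \<sigma> \<Delta> sig(4)])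
  obtain lam B where lam: "lam > 0" and B: "B \<in> sets (noise p n)"
    and sub: "\<And>\<omega>. \<omega> \<in> space (noise p n) \<Longrightarrow>
      ln (real n) / real n + 2 ^ 28 / ?r\<^sup>2 \<le> error_bound p n x \<tau> \<theta> lam \<omega> \<Longrightarrow> \<omega> \<in> B"
    and prob: "measure (noise p n) B \<le> 2 * exp (- real n - ?r\<^sup>2 * ln (real n) / 2 ^ 23)"
    using error_bound_tail[OF n p r rx x \<tau>_def sig(3)] by blast
  have n0: "n > 0" using n by simp
  note err = estimator_error_bound[OF n0 \<sigma> sig(1) \<tau>_def sig(3) x_def sig(2) s0 lam sel]
  have "\<P>(Y in law p n \<sigma> \<theta> \<eta>. 1 / real n * \<bar>\<eta> \<bullet> sign_vec s0 (v Y)\<bar>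
      \<le> 1 - ln (real n) / real n - 2 ^ 28 / ?r\<^sup>2) \<le> measure (noise p n) B"
  proof (rule law_prob_le[OF B])
    fix \<omega> assume \<omega>: "\<omega> \<in> space (noise p n)"
      "1 / real n * \<bar>\<eta> \<bullet> sign_vec s0 (v (observation p n \<sigma> \<theta> \<eta> \<omega>))\<bar> \<le> 1 - ln (real n) / real n - 2 ^ 28 / ?r\<^sup>2"
    show "\<omega> \<in> B" by (rule sub[OF \<omega>(1)]) (use \<omega>(2) err(2)[of \<omega>] in linarith)
  qed
  with prob show ?thesis by linarith
qed

theorem theorem3:
  shows "\<exists>C C' :: real. C > 0 \<and> C' > 0 \<and>
    (\<forall>(p :: nat \<Rightarrow> nat) (\<sigma> :: nat \<Rightarrow> real) (\<Delta> :: nat \<Rightarrow> real)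
      (v :: nat \<Rightarrow> real mat \<Rightarrow> real vec) (s0 :: real).
      (\<forall>n\<ge>2. p n \<ge> 1 \<and> \<sigma> n > 0 \<and> \<Delta> n > 0 \<and> r_ratio (p n) n (\<sigma> n) (\<Delta> n) \<ge> C) \<longrightarrow>
      (\<forall>n\<ge>2. spectral_selection (p n) n (v n)) \<longrightarrow>
      s0 \<in> {-1, 1} \<longrightarrow>
      (\<forall>n\<ge>2.
        (SUP (\<theta>, \<eta>) \<in> Omega (p n) n (\<Delta> n).
          1 / real n * (LINT Y | law (p n) n (\<sigma> n) \<theta> \<eta>. loss n (sign_vec s0 (v n Y)) \<eta>))
        \<le> C' / (r_ratio (p n) n (\<sigma> n) (\<Delta> n))\<^sup>2 + 32 / (real n)\<^sup>2) \<and>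
      (\<exists>\<epsilon> :: nat \<Rightarrow> real. \<epsilon> \<longlonglongrightarrow> 0 \<and>
        (\<forall>n\<ge>2.
          (SUP (\<theta>, \<eta>) \<in> Omega (p n) n (\<Delta> n).
            \<P>(Y in law (p n) n (\<sigma> n) \<theta> \<eta>.
              1 / real n * \<bar>\<eta> \<bullet> sign_vec s0 (v n Y)\<bar>
              \<le> 1 - ln (real n) / real n - C' / (r_ratio (p n) n (\<sigma> n) (\<Delta> n))\<^sup>2))
          \<le> \<epsilon> n * gauss_tail (r_ratio (p n) n (\<sigma> n) (\<Delta> n)))))"
proof (rule exI[of _ 1], rule exI[of _ "2 ^ 28"], intro conjI allI impI)
  fix p :: "nat \<Rightarrow> nat" and \<sigma> \<Delta> :: "nat \<Rightarrow> real" and v :: "nat \<Rightarrow> real mat \<Rightarrow> real vec" and s0 :: real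
  assume par: "\<forall>n\<ge>2. p n \<ge> 1 \<and> \<sigma> n > 0 \<and> \<Delta> n > 0 \<and> r_ratio (p n) n (\<sigma> n) (\<Delta> n) \<ge> 1"
    and sel: "\<forall>n\<ge>2. spectral_selection (p n) n (v n)" and s0: "s0 \<in> {-1, 1}"
  let ?r = "\<lambda>n. r_ratio (p n) n (\<sigma> n) (\<Delta> n)"
  show "(SUP (\<theta>, \<eta>) \<in> Omega (p n) n (\<Delta> n).
        1 / real n * (LINT Y | law (p n) n (\<sigma> n) \<theta> \<eta>. loss n (sign_vec s0 (v n Y)) \<eta>))
      \<le> 2 ^ 28 / (?r n)\<^sup>2 + 32 / (real n)\<^sup>2" if n: "n \<ge> 2" for n
  proof (rule cSUP_least)
    show "Omega (p n) n (\<Delta> n) \<noteq> {}" using par n by (intro Omega_nonempty) auto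
    fix z assume z: "z \<in> Omega (p n) n (\<Delta> n)"
    obtain \<theta> \<eta> where z': "z = (\<theta>, \<eta>)" by (cases z)
    have "1 / real n * (LINT Y | law (p n) n (\<sigma> n) \<theta> \<eta>. loss n (sign_vec s0 (v n Y)) \<eta>) \<le> 2 ^ 28 / (?r n)\<^sup>2"
      by (rule risk_bound) (use par sel s0 n z z' in auto)
    also have "\<dots> \<le> 2 ^ 28 / (?r n)\<^sup>2 + 32 / (real n)\<^sup>2" by simp
    finally show "(case z of (\<theta>, \<eta>) \<Rightarrow>
        1 / real n * (LINT Y | law (p n) n (\<sigma> n) \<theta> \<eta>. loss n (sign_vec s0 (v n Y)) \<eta>))
      \<le> 2 ^ 28 / (?r n)\<^sup>2 + 32 / (real n)\<^sup>2" by (simp only: z' prod.case)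
  qed
  \<comment> \<open>While \<open>ln n\<close> is below the threshold, \<open>\<epsilon> n\<close> makes the claimed bound equal to 1.\<close>
  define \<epsilon> where "\<epsilon> n = (if ln (real n) \<ge> 2 ^ 23 then 2 * exp 1 * sqrt (2 * pi) * exp (- real n)
    else 1 / gauss_tail (?r n))" for n
  have "\<epsilon> \<longlonglongrightarrow> 0"
  proof (rule Lim_transform_eventually)
    have "(\<lambda>n. exp (- real n)) \<longlonglongrightarrow> 0"
      by (intro filterlim_compose[OF exp_at_bot] filterlim_compose[OF filterlim_uminus_at_bot_at_top]
          filterlim_real_sequentially)
    from tendsto_mult_left[OF this, of "2 * exp 1 * sqrt (2 * pi)"]
    show "(\<lambda>n. 2 * exp 1 * sqrt (2 * pi) * exp (- real n)) \<longlonglongrightarrow> 0" by simp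
    have "filterlim (\<lambda>n. ln (real n)) at_top sequentially"
      by (intro filterlim_compose[OF ln_at_top] filterlim_real_sequentially)
    then have "\<forall>\<^sub>F n in sequentially. ln (real n) \<ge> 2 ^ 23" by (simp add: filterlim_at_top)
    then show "\<forall>\<^sub>F n in sequentially. 2 * exp 1 * sqrt (2 * pi) * exp (- real n) = \<epsilon> n"
      by eventually_elim (simp add: \<epsilon>_def)
  qed
  moreover have "(SUP (\<theta>, \<eta>) \<in> Omega (p n) n (\<Delta> n).
        \<P>(Y in law (p n) n (\<sigma> n) \<theta> \<eta>. 1 / real n * \<bar>\<eta> \<bullet> sign_vec s0 (v n Y)\<bar>
          \<le> 1 - ln (real n) / real n - 2 ^ 28 / (?r n)\<^sup>2)) \<le> \<epsilon> n * gauss_tail (?r n)" if n: "n \<ge> 2" for n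
  proof (rule cSUP_least)
    show "Omega (p n) n (\<Delta> n) \<noteq> {}" using par n by (intro Omega_nonempty) auto
    fix z assume z: "z \<in> Omega (p n) n (\<Delta> n)"
    obtain \<theta> \<eta> where z': "z = (\<theta>, \<eta>)" by (cases z)
    let ?P = "\<P>(Y in law (p n) n (\<sigma> n) \<theta> \<eta>. 1 / real n * \<bar>\<eta> \<bullet> sign_vec s0 (v n Y)\<bar>
          \<le> 1 - ln (real n) / real n - 2 ^ 28 / (?r n)\<^sup>2)"
    have r: "?r n \<ge> 1" using par n by simp
    have low: "exp (- (?r n)\<^sup>2 - 1) / sqrt (2 * pi) \<le> gauss_tail (?r n)" using r by (intro gauss_tail_lower) simp
    have "?P \<le> \<epsilon> n * gauss_tail (?r n)"
    proof (cases "ln (real n) \<ge> 2 ^ 23")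
      case True
      have "?P \<le> 2 * exp (- real n - (?r n)\<^sup>2 * ln (real n) / 2 ^ 23)"
        by (rule overlap_tail) (use par sel s0 n z z' in auto)
      also have "\<dots> \<le> 2 * exp (- real n - (?r n)\<^sup>2)"
      proof -
        have "(?r n)\<^sup>2 * 2 ^ 23 \<le> (?r n)\<^sup>2 * ln (real n)" using True by (intro mult_left_mono) auto
        then show ?thesis by simp
      qed
      also have "\<dots> = (2 * exp 1 * sqrt (2 * pi) * exp (- real n)) * (exp (- (?r n)\<^sup>2 - 1) / sqrt (2 * pi))"
        by (simp add: exp_diff exp_minus field_simps)
      also have "\<dots> \<le> (2 * exp 1 * sqrt (2 * pi) * exp (- real n)) * gauss_tail (?r n)"
        by (intro mult_left_mono low) simp
      finally show ?thesis using True by (simp add: \<epsilon>_def)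
    next
      case False
      have "0 < exp (- (?r n)\<^sup>2 - 1) / sqrt (2 * pi)" by simp
      then have "gauss_tail (?r n) > 0" using low by linarith
      then have "\<epsilon> n * gauss_tail (?r n) = 1" using False by (simp add: \<epsilon>_def)
      moreover have "prob_space (law (p n) n (\<sigma> n) \<theta> \<eta>)"
        unfolding law_def by (intro prob_space.prob_space_distr prob_space_noise observation_measurable)
      then have "?P \<le> 1" by (rule prob_space.prob_le_1)
      ultimately show ?thesis by simp
    qed
    then show "(case z of (\<theta>, \<eta>) \<Rightarrow>
        \<P>(Y in law (p n) n (\<sigma> n) \<theta> \<eta>. 1 / real n * \<bar>\<eta> \<bullet> sign_vec s0 (v n Y)\<bar>
          \<le> 1 - ln (real n) / real n - 2 ^ 28 / (?r n)\<^sup>2)) \<le> \<epsilon> n * gauss_tail (?r n)"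
      by (simp only: z' prod.case)
  qed
  ultimately show "\<exists>\<epsilon> :: nat \<Rightarrow> real. \<epsilon> \<longlonglongrightarrow> 0 \<and>
      (\<forall>n\<ge>2. (SUP (\<theta>, \<eta>) \<in> Omega (p n) n (\<Delta> n).
        \<P>(Y in law (p n) n (\<sigma> n) \<theta> \<eta>. 1 / real n * \<bar>\<eta> \<bullet> sign_vec s0 (v n Y)\<bar>
          \<le> 1 - ln (real n) / real n - 2 ^ 28 / (?r n)\<^sup>2)) \<le> \<epsilon> n * gauss_tail (?r n))"
    by blast
qed simp_all

end
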